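(* Let $f$ be a continuous function, defined in $\mathbb{R}^3$, which is compactly supported in the half space $x_3>0$. For $\lambda\ge0$, $-\pi/2\le\theta<\pi/2$, $-\pi\le\phi<\pi$ let $$G(\lambda,\theta,\phi)=\int_{l_{\lambda,\theta,\phi}}f\,dl,$$ where $dl$ is the infinitesimal length measure on the line $$l_{\lambda,\theta,\phi}=\{(\lambda\cos\phi-t\cos\theta\sin\phi,\ \lambda\sin\phi+t\cos\theta\cos\phi,\ t\sin\theta):t\in\mathbb{R}\}.$$ Let $$f(r\cos\varphi,r\sin\varphi,\tau)=\sum_{n=-\infty}^\infty f_n(r,\tau)e^{in\varphi},\qquad G(\lambda,\theta,\phi)=\sum_{n=-\infty}^\infty G_n(\lambda,\theta)e^{in\phi}$$ be the Fourier expansions of $f$ and $G$ respectively in the variables $\varphi$ and $\phi$. Define $$G_n^{\ast}(\lambda,s)=\frac{G_n(\lambda,\arctan s)}{\sqrt{1+s^2}},\qquad \lambda,s\ge0,$$ $$G_n^{\ast\ast}(\lambda,\xi)=\lambda^{\xi-n-1}\,\mathcal{M}_2[G_n^\ast](\lambda,\xi),\qquad \lambda\ge0,\ 0<\Re(\xi)<1,$$ $$U_n(\zeta,\xi)=\frac{\mathcal{M}_1[G_n^{\ast\ast}](\zeta,\xi)}{\mathcal{I}_n(\zeta,\xi)},\qquad \Re(\zeta)>n',\ 0<\Re(\xi)<1,$$ where $n'=\max(0,n+1)$ and $$\mathcal{I}_n(\zeta,\xi)=\int_0^\infty(1+t^2)^{-\zeta/2}\,t^{-\xi}(1+it)^n\,dt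 .$$ Then $$f_n(r,\tau)=r^n\,\mathcal{M}_2^{-1}\big[\mathcal{M}_1^{-1}[U_n(\cdot,\xi)]\big](r,\tau),\qquad r,\tau\ge0,$$ where in $\mathcal{M}_1^{-1}$ (integration with respect to $\zeta$) the abscissa $\varrho$ of the line of integration is taken from $(n',\infty)$, and in $\mathcal{M}_2^{-1}$ (integration with respect to $\xi$) it is taken from $(0,1)$.
   Context: The Mellin transform of a function $F$ on $[0,\infty)$ is $(\mathcal{M}F)(s)=\int_0^\infty y^{s-1}F(y)\,dy$, $\Re s>0$, wherever the integral converges. For a function of two variables, $\mathcal{M}_i$ ($i=1,2$) denotes the Mellin transform with respect to the $i$-th variable. The inverse Mellin transform is given by $$F(r)=\mathcal{M}^{-1}(\mathcal{M}F)(r)=\frac{1}{2\pi i}\int_{\varrho-i\infty}^{\varrho+i\infty}r^{-s}(\mathcal{M}F)(s)\,ds,$$ and $\mathcal{M}_i^{-1}$ is this operation in the $i$-th variable: $\mathcal{M}_1^{-1}$ passes from $\zeta$ to $r$, and $\mathcal{M}_2^{-1}$ passes from $\xi$ to $\tau$. The lines $l_{\lambda,\theta,\phi}$ are the lines in $\mathbb{R}^3$ which have equal distances from the two points $e_3=(0,0,1)$ and $-e_3$.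
   Formalization: For merely continuous f the inverse Mellin integrals may diverge; the formula is proved with both taken as Cesàro means of symmetric truncations, and literally wherever inner (for every ξ on the line) and outer limits converge. At r=0 or τ=0 it holds as a limit from r,τ>0. *)

theory Defs
  imports "HOL-Analysis.Analysis" "HOL-Complex_Analysis.Complex_Analysis"
begin

definition mellin :: "(real \<Rightarrow> complex) \<Rightarrow> complex \<Rightarrow> complex" where
  "mellin F s = (LINT y:{0..}|lborel. of_real y powr (s - 1) * F y)"

text \<open>
  The inverse Mellin transform of \<open>H\<close> at \<open>r > 0\<close> is the integral of \<open>r powr (-s) * H s\<close> over the
  whole line \<open>Re s = \<rho>\<close>, divided by \<open>2 * pi * \<i>\<close>. The truncated integral runs from \<open>\<rho> - \<i> T\<close>
  to \<open>\<rho> + \<i> T\<close>.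
\<close>

definition inv_mellin_trunc :: "real \<Rightarrow> (complex \<Rightarrow> complex) \<Rightarrow> real \<Rightarrow> real \<Rightarrow> complex" where
  "inv_mellin_trunc \<rho> H r T =
     1 / (2 * of_real pi * \<i>) *
     contour_integral (linepath (Complex \<rho> (-T)) (Complex \<rho> T)) (\<lambda>s. of_real r powr (-s) * H s)"

definition has_inv_mellin :: "real \<Rightarrow> (complex \<Rightarrow> complex) \<Rightarrow> real \<Rightarrow> complex \<Rightarrow> bool" where
  "has_inv_mellin \<rho> H r v \<longleftrightarrow> (inv_mellin_trunc \<rho> H r \<longlongrightarrow> v) at_top"

text \<open>
  For a function that is merely continuous, the line integral inverting its Mellin transform need
  not converge at a given point, exactly as for Fourier inversion, not even as a symmetric limit.
  Taken in the Cesaro (Fejer) sense, as the limit of the means of the truncated integrals, it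
  always does. This is consistent with \<open>has_inv_mellin\<close>: where the truncated integrals converge,
  their means have the same limit.
\<close>

definition has_inv_mellin_C1 :: "real \<Rightarrow> (complex \<Rightarrow> complex) \<Rightarrow> real \<Rightarrow> complex \<Rightarrow> bool" where
  "has_inv_mellin_C1 \<rho> H r v \<longleftrightarrow>
     ((\<lambda>T. of_real (1 / T) * integral {0..T} (inv_mellin_trunc \<rho> H r)) \<longlongrightarrow> v) at_top"

definition line_pt :: "real \<Rightarrow> real \<Rightarrow> real \<Rightarrow> real \<Rightarrow> real^3" where
  "line_pt l \<theta> \<phi> t =
     vector [l * cos \<phi> - t * cos \<theta> * sin \<phi>, l * sin \<phi> + t * cos \<theta> * cos \<phi>, t * sin \<theta>]"

text \<open>The length element on the line is the speed of the parametrisation times \<open>dt\<close>.\<close>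

definition line_int :: "(real^3 \<Rightarrow> complex) \<Rightarrow> real \<Rightarrow> real \<Rightarrow> real \<Rightarrow> complex" where
  "line_int f l \<theta> \<phi> =
     (LINT t|lborel. norm (vector_derivative (line_pt l \<theta> \<phi>) (at t)) *\<^sub>R f (line_pt l \<theta> \<phi> t))"

definition fourier_coeff :: "int \<Rightarrow> (real \<Rightarrow> complex) \<Rightarrow> complex" where
  "fourier_coeff n g =
     1 / (2 * of_real pi) * (LINT \<phi>:{-pi..pi}|lborel. g \<phi> * exp (- \<i> * of_int n * of_real \<phi>))"

definition f_coeff :: "(real^3 \<Rightarrow> complex) \<Rightarrow> int \<Rightarrow> real \<Rightarrow> real \<Rightarrow> complex" where
  "f_coeff f n r \<tau> = fourier_coeff n (\<lambda>\<phi>. f (vector [r * cos \<phi>, r * sin \<phi>, \<tau>]))"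

definition G_coeff :: "(real^3 \<Rightarrow> complex) \<Rightarrow> int \<Rightarrow> real \<Rightarrow> real \<Rightarrow> complex" where
  "G_coeff f n l \<theta> = fourier_coeff n (line_int f l \<theta>)"

definition G_star :: "(real^3 \<Rightarrow> complex) \<Rightarrow> int \<Rightarrow> real \<Rightarrow> real \<Rightarrow> complex" where
  "G_star f n l s = G_coeff f n l (arctan s) / of_real (sqrt (1 + s\<^sup>2))"

definition G_star2 :: "(real^3 \<Rightarrow> complex) \<Rightarrow> int \<Rightarrow> real \<Rightarrow> complex \<Rightarrow> complex" where
  "G_star2 f n l \<xi> = of_real l powr (\<xi> - of_int n - 1) * mellin (G_star f n l) \<xi>"

definition I_fun :: "int \<Rightarrow> complex \<Rightarrow> complex \<Rightarrow> complex" where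
  "I_fun n \<zeta> \<xi> =
     (LINT t:{0..}|lborel.
        of_real (1 + t\<^sup>2) powr (- \<zeta> / 2) * of_real t powr (- \<xi>) * (1 + \<i> * of_real t) powi n)"

text \<open>
  The integral \<open>I_fun n \<zeta> \<xi>\<close> is holomorphic and not identically zero in \<open>\<zeta>\<close>, so for fixed \<open>\<xi>\<close> its
  possible zeros, where the quotient below is \<open>0\<close> by convention, form a null set on each line of
  integration.
\<close>

definition U_fun :: "(real^3 \<Rightarrow> complex) \<Rightarrow> int \<Rightarrow> complex \<Rightarrow> complex \<Rightarrow> complex" where
  "U_fun f n \<zeta> \<xi> = mellin (\<lambda>l. G_star2 f n l \<xi>) \<zeta> / I_fun n \<zeta> \<xi>"

end

theory Submission
  imports Defs "HOL-Probability.Sinc_Integral"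
begin

text \<open>
  Put \<open>t = u * sqrt (1 + s\<^sup>2)\<close> on the line with slope \<open>s = tan \<theta>\<close>: its points are
  \<open>(exp (\<i> * \<phi>) * (l + \<i> * u), s * u)\<close> in \<open>\<complex> \<times> \<real>\<close>. Hence the \<open>n\<close>-th Fourier coefficient of the line
  integral is a superposition over \<open>u\<close>, with weights of modulus one, of \<open>f\<^sub>n (sqrt (l\<^sup>2 + u\<^sup>2), s * u)\<close>, which involves only dilations
  in \<open>s\<close> and, after substituting \<open>u = l * t\<close>, only dilations in \<open>l\<close>. The two Mellin transforms turn it
  into \<open>I_fun n \<zeta> \<xi>\<close> times the double Mellin transform of \<open>f\<^sub>n\<close> at \<open>(\<zeta> - n, \<xi>)\<close>. As \<open>I_fun\<close> is holomorphic
  and not identically zero in \<open>\<zeta>\<close>, its zeros are countable and do not affect the inversion integral,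
  and Fejer's theorem inverts both Mellin transforms at every point of continuity.
\<close>

section \<open>Bounded kernels and the Mellin transform\<close>

text \<open>For a merely continuous \<open>f\<close> the Mellin transforms need not decay along
  vertical lines, so no absolutely convergent inversion integral is at hand and Fubini's theorem is
  applied only after truncation. With \<open>x = r * exp u\<close> the truncated inversion at
  \<open>r\<close> becomes an integral against the Dirichlet kernel at the origin, and averaging
  over the truncation replaces this kernel by the nonnegative Fejer kernel. Uniqueness uses the same
  reduction: a limit of truncated integrals is also the limit of their means. The shift
  \<open>\<zeta> - n\<close> arises because the power of \<open>l\<close> in \<open>G_star2\<close>
  cancels the Jacobian of \<open>u = l * t\<close> only up to \<open>l powr (- n)\<close>. Hence the
  inversion in \<open>\<zeta>\<close> recovers \<open>r powi (- n)\<close> times the coefficient,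
  which explains the factor \<open>r powi n\<close> in the formula. The abscissas come from
  integrability of the kernel: \<open>Re \<xi> < 1\<close> handles \<open>t = 0\<close>, and
  \<open>Re \<zeta> > n + 1\<close> with \<open>Re \<xi> > 0\<close> handles infinity.\<close>

lemma
  fixes g :: "real \<Rightarrow> complex" and k :: "real \<Rightarrow> real \<Rightarrow> complex"
  assumes g: "integrable lborel g"
    and k[measurable]: "case_prod k \<in> borel_measurable (borel \<Otimes>\<^sub>M borel)"
    and bd: "\<And>y u. y \<in> {a..b} \<Longrightarrow> norm (k y u) \<le> B"
  shows Fubini_bounded_kernel:
      "(LINT y:{a..b}|lborel. LINT u|lborel. g u * k y u) =
       (LINT u|lborel. g u * (LINT y:{a..b}|lborel. k y u))" (is ?eq)
    and set_integrable_bounded_kernel: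
      "set_integrable lborel {a..b} (\<lambda>y. LINT u|lborel. g u * k y u)" (is ?int)
proof -
  have [measurable]: "g \<in> borel_measurable borel"
    using borel_measurable_integrable[OF g] by simp
  let ?f = "\<lambda>u y. indicator {a..b} y *\<^sub>R (g u * k y u)"
  have m: "case_prod ?f \<in> borel_measurable (lborel \<Otimes>\<^sub>M lborel)"
    by measurable
  \<comment> \<open>Truncating \<open>y\<close> to \<open>{a..b}\<close> is what makes the majorant
    \<open>B * norm (g u)\<close> integrable in both variables together.\<close>
  have int: "integrable (lborel \<Otimes>\<^sub>M lborel) (case_prod ?f)"
  proof (rule Bochner_Integration.integrable_bound[OF _ m])
    have ind: "integrable lborel (indicator {a..b} :: real \<Rightarrow> real)"
      by (intro integrable_real_indicator) (auto simp: emeasure_lborel_Icc_eq)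
    show "integrable (lborel \<Otimes>\<^sub>M lborel) (\<lambda>(u, y). (B * norm (g u)) * (indicator {a..b} y :: real))"
      using integrable_norm[OF g] ind
      by (intro lborel_pair.Fubini_integrable) (auto simp: abs_mult)
    show "AE z in lborel \<Otimes>\<^sub>M lborel. norm (case_prod ?f z) \<le>
      norm (case z of (u, y) \<Rightarrow> (B * norm (g u)) * (indicator {a..b} y :: real))"
    proof (intro AE_I2, clarify)
      fix u y :: real
      show "norm (?f u y) \<le> norm ((B * norm (g u)) * (indicator {a..b} y :: real))"
      proof (cases "y \<in> {a..b}")
        case True
        from bd[OF this, of u] have "0 \<le> B" by (meson norm_ge_zero order_trans)
        moreover have "norm (g u) * norm (k y u) \<le> norm (g u) * B"
          by (intro mult_left_mono bd True) auto
        ultimately show ?thesis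
          using True by (simp add: norm_mult mult.commute)
      qed simp
    qed
  qed
  have "(LINT y|lborel. LINT u|lborel. ?f u y) = (LINT u|lborel. LINT y|lborel. ?f u y)"
    by (rule lborel_pair.Fubini_integral[OF int])
  moreover have "(LINT u|lborel. ?f u y) = indicator {a..b} y *\<^sub>R (LINT u|lborel. g u * k y u)" for y
    by simp
  moreover have "(LINT y|lborel. ?f u y) = g u * (LINT y:{a..b}|lborel. k y u)" for u
    unfolding set_lebesgue_integral_def
    by (simp add: scaleR_conv_of_real mult.left_commute flip: integral_mult_right_zero)
  ultimately show ?eq
    unfolding set_lebesgue_integral_def by simp
  have "integrable lborel (\<lambda>y. LINT u|lborel. ?f u y)"
    using lborel_pair.integrable_snd[OF int] .
  then show ?int
    unfolding set_integrable_def by simp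
qed

lemma mellin_eq_integral_pos: "mellin F s = (LINT y:{0<..}|lborel. of_real y powr (s - 1) * F y)"
  unfolding mellin_def set_lebesgue_integral_def
  by (rule integral_discrete_difference[where X = "{0}"]) (auto simp: indicator_def)

lemma mellin_cong:
  assumes "\<And>y. y > 0 \<Longrightarrow> F y = G y"
  shows "mellin F s = mellin G s"
  unfolding mellin_eq_integral_pos
  by (intro set_lebesgue_integral_cong) (auto simp: assms)

text \<open>A nonnegative gauge-integrable function is absolutely integrable, and Borel
  measurability brings it down from the completion to \<open>lborel\<close>; the known integrals of
  real powers enter this way.\<close>

lemma set_integrable_lborel_nonneg:
  fixes f :: "real \<Rightarrow> real"
  assumes "f integrable_on S" "\<And>x. x \<in> S \<Longrightarrow> f x \<ge> 0"
    and [measurable]: "S \<in> sets borel" "f \<in> borel_measurable borel"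
  shows "set_integrable lborel S f"
proof -
  have "f absolutely_integrable_on S"
    using assms(1,2) by (simp add: absolutely_integrable_on_iff_nonneg)
  moreover have "(\<lambda>x. indicator S x *\<^sub>R f x) \<in> borel_measurable lborel"
    by measurable
  ultimately show ?thesis
    using integrable_completion[of "\<lambda>x. indicator S x *\<^sub>R f x" lborel] by (simp only: set_integrable_def)
qed

section \<open>Fejer means\<close>

text \<open>The Fejer kernel of the real line: for \<open>T > 0\<close> and \<open>u\<close>
  nonzero, \<open>T * fejer (T * u)\<close> is the mean of \<open>dirichlet y u\<close> over
  \<open>y\<close> in \<open>{0..T}\<close>. Division by zero gives \<open>fejer 0 = 0\<close>
  instead of the continuous value \<open>1 / (2 * pi)\<close>, a change on a null set.\<close>

definition fejer :: "real \<Rightarrow> real" where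
  "fejer u = (1 - cos u) / (pi * u\<^sup>2)"

lemma fejer_nonneg: "fejer u \<ge> 0"
  by (simp add: fejer_def)

lemma fejer_measurable [measurable]: "fejer \<in> borel_measurable borel"
  unfolding fejer_def by measurable

lemma fejer_minus [simp]: "fejer (- u) = fejer u"
  by (simp add: fejer_def)

text \<open>Integration by parts leads to the sine integral: the boundary term
  \<open>(1 - cos u) / u\<close> vanishes at 0 and at infinity while \<open>Si\<close> tends to
  \<open>pi / 2\<close>, so each half line carries mass 1/2.\<close>

lemma has_bochner_integral_fejer: "has_bochner_integral lborel fejer 1"
proof -
  define F where "F = (\<lambda>u. (Si u - (1 - cos u) / u) / pi)"
  have der: "DERIV F u :> fejer u" if "0 < ereal u" for u
  proof -
    have "u > 0" using that by simp
    then show ?thesis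
      unfolding F_def fejer_def
      by (auto intro!: derivative_eq_intros DERIV_Si simp: field_simps power2_eq_square)
  qed
  have Si0: "(Si \<longlongrightarrow> 0) (at_right 0)"
  proof -
    have "isCont Si 0" using DERIV_Si DERIV_isCont by blast
    moreover have "Si 0 = 0" by (simp add: Si_alt_def zero_ereal_def[symmetric])
    ultimately show ?thesis
      by (metis isCont_def tendsto_within_subset top_greatest)
  qed
  have "((\<lambda>u. (1 - cos u) / u) \<longlongrightarrow> 0) (at_right (0::real))" "((\<lambda>u. (1 - cos u) / u) \<longlongrightarrow> 0) (at_top :: real filter)"
    by real_asymp+
  then have "(F \<longlongrightarrow> (0 - 0) / pi) (at_right 0)" "(F \<longlongrightarrow> (pi / 2 - 0) / pi) at_top"
    unfolding F_def using Si0 Si_at_top by (intro tendsto_intros; simp)+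
  then have lim: "((F \<circ> real_of_ereal) \<longlongrightarrow> 0) (at_right 0)" "((F \<circ> real_of_ereal) \<longlongrightarrow> 1 / 2) (at_left \<infinity>)"
    by (simp_all add: ereal_tendsto_simps zero_ereal_def)
  have cont: "isCont fejer u" if "0 < ereal u" for u
    unfolding fejer_def using that by (intro continuous_intros) auto
  have "set_integrable lborel (einterval 0 \<infinity>) fejer" "(LBINT x=0..\<infinity>. fejer x) = 1/2 - 0"
    by (rule interval_integral_FTC_nonneg[where F = F];
        use der cont lim fejer_nonneg in auto)+
  then have pos: "has_bochner_integral lborel (\<lambda>x. indicator {0<..} x *\<^sub>R fejer x) (1/2)"
    unfolding set_integrable_def interval_lebesgue_integral_def set_lebesgue_integral_def
    by (simp add: has_bochner_integral_iff einterval_eq zero_ereal_def)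
  then have "has_bochner_integral lborel (\<lambda>x. indicator {0<..} (-x) *\<^sub>R fejer (-x)) (1/2)"
    using lborel_has_bochner_integral_real_affine_iff[of "-1" "\<lambda>x. indicator {0<..} x *\<^sub>R fejer x" "1/2" 0]
    by simp
  from has_bochner_integral_add[OF pos this]
  have "has_bochner_integral lborel
    (\<lambda>x. indicator {0<..} x *\<^sub>R fejer x + indicator {0<..} (-x) *\<^sub>R fejer (-x)) 1"
    by simp
  then show ?thesis
    by (rule has_bochner_integral_cong[THEN iffD1, rotated -1])
       (auto simp: fejer_def indicator_def)
qed

text \<open>After the rescaling \<open>v = T * u\<close> the kernel no longer depends on
  \<open>T\<close>, and \<open>g\<close> is evaluated at \<open>v / T\<close>, which tends to 0.
  Boundedness of \<open>g\<close> supplies the majorant \<open>B * fejer v\<close>.\<close>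

lemma fejer_approximate_identity:
  fixes g :: "real \<Rightarrow> complex"
  assumes [measurable]: "g \<in> borel_measurable borel"
    and bd: "\<And>u. norm (g u) \<le> B" and cont: "isCont g 0"
  shows "((\<lambda>T. LINT u|lborel. g u * of_real (T * fejer (T * u))) \<longlongrightarrow> g 0) at_top"
proof -
  have "((\<lambda>T. LINT v|lborel. g (v / T) * of_real (fejer v)) \<longlongrightarrow> (LINT v|lborel. g 0 * of_real (fejer v))) at_top"
  proof (rule integral_dominated_convergence_at_top)
    show "integrable lborel (\<lambda>v. B * fejer v)"
      using has_bochner_integral_fejer by (auto simp: has_bochner_integral_iff)
    show "\<forall>\<^sub>F T in at_top. AE v in lborel. norm (g (v / T) * of_real (fejer v)) \<le> B * fejer v"
      using bd by (intro always_eventually allI AE_I2) (auto simp: norm_mult fejer_nonneg intro!: mult_right_mono)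
    show "AE v in lborel. ((\<lambda>T. g (v / T) * of_real (fejer v)) \<longlongrightarrow> g 0 * of_real (fejer v)) at_top"
    proof (intro AE_I2 tendsto_mult tendsto_const)
      fix v :: real
      have "((\<lambda>T. v / T) \<longlongrightarrow> 0) at_top"
        by real_asymp
      with cont show "((\<lambda>T. g (v / T)) \<longlongrightarrow> g 0) at_top"
        by (rule isCont_tendsto_compose)
    qed
  qed measurable
  also have "(LINT v|lborel. g 0 * complex_of_real (fejer v)) = g 0"
    using has_bochner_integral_fejer by (simp add: has_bochner_integral_iff)
  finally show ?thesis
  proof (rule Lim_transform_eventually)
    show "\<forall>\<^sub>F T in at_top. (LINT v|lborel. g (v / T) * of_real (fejer v)) = (LINT u|lborel. g u * of_real (T * fejer (T * u)))"
      using eventually_gt_at_top[of 0]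
    proof eventually_elim
      case (elim T)
      then show ?case
        by (subst lborel_integral_real_affine[of T _ 0])
           (auto simp: scaleR_conv_of_real mult_ac simp flip: integral_mult_right_zero)
    qed
  qed
qed

text \<open>The kernel \<open>sin (T * u) / (pi * u)\<close>; written with \<open>sinc\<close> it
  takes its continuous value \<open>T / pi\<close> at \<open>u = 0\<close>.\<close>

definition dirichlet :: "real \<Rightarrow> real \<Rightarrow> real" where
  "dirichlet T u = T / pi * sinc (T * u)"

lemma dirichlet_measurable [measurable]:
  "(\<lambda>(T, u). dirichlet T u) \<in> borel_measurable (borel \<Otimes>\<^sub>M borel)"
  unfolding dirichlet_def by measurable

lemma integral_exp_dirichlet:
  assumes "T \<ge> 0"
  shows "(LINT y:{-T..T}|lborel. exp (\<i> * of_real (y * u))) = 2 * of_real pi * of_real (dirichlet T u)"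
proof (cases "u = 0")
  case True
  then show ?thesis
    using assms by (simp add: dirichlet_def set_lebesgue_integral_def scaleR_conv_of_real)
next
  case False
  define F where "F = (\<lambda>y. exp (\<i> * of_real (y * u)) / (\<i> * of_real u))"
  have "(F has_vector_derivative exp (\<i> * of_real (y * u))) (at y within {-T..T})" for y
    unfolding F_def using False
    by (auto intro!: derivative_eq_intros has_vector_derivative_real_field simp: field_simps)
  then have "((\<lambda>y. exp (\<i> * of_real (y * u))) has_integral (F T - F (-T))) {-T..T}"
    using assms by (intro fundamental_theorem_of_calculus) auto
  moreover have "set_integrable lborel {-T..T} (\<lambda>y. exp (\<i> * of_real (y * u)))"
    by (intro borel_integrable_atLeastAtMost' continuous_intros)
  ultimately have "(LINT y:{-T..T}|lborel. exp (\<i> * of_real (y * u))) = F T - F (-T)"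
    using set_borel_integral_eq_integral(2) integral_unique by metis
  also have "\<dots> = 2 * of_real (sin (T * u)) / of_real u"
    unfolding F_def using False
    by (simp add: sin_of_real[symmetric] sin_exp_eq field_simps flip: of_real_mult)
  also have "\<dots> = 2 * of_real pi * of_real (dirichlet T u)"
    using False assms by (auto simp: dirichlet_def)
  finally show ?thesis .
qed

lemma integral_dirichlet:
  assumes "T > 0" "u \<noteq> 0"
  shows "(LINT y:{0..T}|lborel. complex_of_real (dirichlet y u)) = of_real (T * (T * fejer (T * u)))"
proof -
  define F where "F = (\<lambda>y. - cos (y * u) / (pi * u\<^sup>2))"
  have "(F has_vector_derivative dirichlet y u) (at y within {0..T})" for y
    unfolding F_def has_real_derivative_iff_has_vector_derivative[symmetric] using assms(2)
    by (auto intro!: derivative_eq_intros simp: dirichlet_def field_simps power2_eq_square)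
  then have "((\<lambda>y. dirichlet y u) has_integral (F T - F 0)) {0..T}"
    using assms by (intro fundamental_theorem_of_calculus) auto
  moreover have "set_integrable lborel {0..T} (\<lambda>y. dirichlet y u)"
    unfolding dirichlet_def by (intro borel_integrable_atLeastAtMost' continuous_intros) auto
  ultimately have "(LINT y:{0..T}|lborel. dirichlet y u) = F T - F 0"
    using set_borel_integral_eq_integral(2) integral_unique by metis
  also have "\<dots> = T * (T * fejer (T * u))"
    using assms by (simp add: F_def fejer_def field_simps power2_eq_square)
  finally show ?thesis
    by (simp add: set_integral_complex_of_real)
qed

text \<open>The sine is 1-Lipschitz, so the numerators differ by at most
  \<open>\<bar>T - S\<bar> * \<bar>u\<bar>\<close> and the denominator cancels. Uniformity in
  \<open>u\<close> makes integrals against the kernel Lipschitz in \<open>T\<close>; the case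
  \<open>S = 0\<close> bounds the kernel itself.\<close>

lemma abs_dirichlet_diff_le: "\<bar>dirichlet T u - dirichlet S u\<bar> \<le> \<bar>T - S\<bar> / pi"
proof (cases "u = 0")
  case True
  then show ?thesis by (simp add: dirichlet_def flip: diff_divide_distrib)
next
  case False
  have "dirichlet T u = sin (T * u) / (pi * u)" for T
    using False by (auto simp: dirichlet_def)
  then have "\<bar>dirichlet T u - dirichlet S u\<bar> = \<bar>sin (T * u) - sin (S * u)\<bar> / (pi * \<bar>u\<bar>)"
    by (simp add: abs_mult flip: diff_divide_distrib)
  also have "\<bar>sin (T * u) - sin (S * u)\<bar> \<le> \<bar>T * u - S * u\<bar>"
  proof -
    have "\<bar>sin (T * u) - sin (S * u)\<bar> =
        2 * \<bar>sin ((T * u - S * u) / 2)\<bar> * \<bar>cos ((T * u + S * u) / 2)\<bar>"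
      by (simp add: sin_diff_sin abs_mult)
    also have "\<dots> \<le> 2 * \<bar>(T * u - S * u) / 2\<bar> * 1"
      by (intro mult_mono abs_sin_x_le_abs_x abs_cos_le_one) auto
    finally show ?thesis by simp
  qed
  also have "\<dots> / (pi * \<bar>u\<bar>) = \<bar>T - S\<bar> / pi"
    using False by (simp add: abs_mult flip: left_diff_distrib)
  finally show ?thesis by (simp add: divide_right_mono)
qed

lemma abs_dirichlet_le: "\<bar>dirichlet T u\<bar> \<le> \<bar>T\<bar> / pi"
  using abs_dirichlet_diff_le[of T u 0] by (simp add: dirichlet_def)

section \<open>Inversion of the Mellin transform\<close>

text \<open>This is l'Hospital's rule for the quotient of the integral by \<open>T\<close>, in the
  form that asks only for a denominator tending to infinity. The rule is real, hence the split into
  real and imaginary parts.\<close>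

lemma cesaro_mean_tendsto:
  fixes D :: "real \<Rightarrow> complex"
  assumes cont: "continuous_on UNIV D" and lim: "(D \<longlongrightarrow> v) at_top"
  shows "((\<lambda>T. of_real (1 / T) * integral {0..T} D) \<longlongrightarrow> v) at_top"
proof -
  have real: "((\<lambda>T. integral {0..T} d / T) \<longlongrightarrow> l) at_top"
    if d: "continuous_on UNIV d" "(d \<longlongrightarrow> l) at_top" for d :: "real \<Rightarrow> real" and l
  proof (rule lhospital_at_top_at_top[where f' = d and g' = "\<lambda>_. 1"])
    show "\<forall>\<^sub>F T in at_top. DERIV (\<lambda>T. integral {0..T} d) T :> d T"
      using eventually_gt_at_top[of 0]
    proof eventually_elim
      case (elim T)
      have "((\<lambda>T. integral {0..T} d) has_real_derivative d T) (at T within {0..T + 1})"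
        using d(1) elim by (intro integral_has_real_derivative) (auto intro: continuous_on_subset)
      then show ?case
        using elim by (subst (asm) at_within_Icc_at) auto
    qed
  qed (use d in \<open>auto intro: filterlim_ident\<close>)
  have int: "D integrable_on {0..T}" for T
    using cont by (intro integrable_continuous_real) (auto intro: continuous_on_subset)
  have "((\<lambda>T. Complex (integral {0..T} (\<lambda>x. Re (D x)) / T) (integral {0..T} (\<lambda>x. Im (D x)) / T))
      \<longlongrightarrow> Complex (Re v) (Im v)) at_top"
    using cont lim by (intro tendsto_Complex real tendsto_Re tendsto_Im continuous_intros)
  moreover have "Complex (integral {0..T} (\<lambda>x. Re (D x)) / T) (integral {0..T} (\<lambda>x. Im (D x)) / T) =
      of_real (1 / T) * integral {0..T} D" for T
    using integral_linear[OF int[of T] bounded_linear_Re] integral_linear[OF int[of T] bounded_linear_Im]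
    by (simp add: complex_eq_iff o_def)
  ultimately show ?thesis by simp
qed

text \<open>The exponential carries the multiplicative half line to the additive line, with the base
  point \<open>r\<close> at \<open>u = 0\<close>. The change of variables is made for absolute gauge
  integrals; Borel measurability of \<open>?K\<close> brings the result back to
  \<open>lborel\<close>.\<close>

lemma
  fixes F :: "real \<Rightarrow> complex"
  assumes F: "set_integrable lborel {0<..} F" and "r > 0"
  shows integrable_exp_substitution: "integrable lborel (\<lambda>u. of_real (r * exp u) * F (r * exp u))"
    and integral_exp_substitution:
      "(LINT u|lborel. of_real (r * exp u) * F (r * exp u)) = (LINT x:{0<..}|lborel. F x)"
proof -
  let ?G = "\<lambda>x. indicator {0<..} x *\<^sub>R F x"
  let ?K = "\<lambda>u. \<bar>r * exp u\<bar> *\<^sub>R ?G (r * exp u)"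
  have [measurable]: "?G \<in> borel_measurable borel"
    using borel_measurable_integrable[OF F[unfolded set_integrable_def]] by simp
  have "(\<lambda>u. ?G (r * exp u)) \<in> borel_measurable borel"
    by (rule measurable_compose[of "\<lambda>u. r * exp u" borel borel ?G]) measurable
  then have K[measurable]: "?K \<in> borel_measurable borel"
    by (intro borel_measurable_scaleR[where g = "\<lambda>u. ?G (r * exp u)"] borel_measurable_abs) measurable
  have img: "range (\<lambda>u. r * exp u) = {0<..}"
  proof safe
    fix x :: real assume "x > 0"
    with \<open>r > 0\<close> show "x \<in> range (\<lambda>u. r * exp u)"
      by (intro range_eqI[of _ _ "ln (x / r)"]) auto
  qed (use \<open>r > 0\<close> in auto)
  have "?G absolutely_integrable_on {0<..}"
    using F unfolding set_integrable_def by (simp add: integrable_completion mult.assoc[symmetric] flip: indicator_inter_arith)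
  then have "?K absolutely_integrable_on UNIV \<and> integral UNIV ?K = integral {0<..} ?G"
    using has_absolute_integral_change_of_variables_real
      [of UNIV "\<lambda>u. r * exp u" "\<lambda>u. r * exp u" ?G "integral {0<..} ?G"] \<open>r > 0\<close> img
    by (force intro!: derivative_eq_intros simp: inj_on_def)
  moreover have "?K absolutely_integrable_on UNIV \<longleftrightarrow> integrable lborel ?K"
    using integrable_completion[of ?K lborel] by (simp add: set_integrable_def del: abs_mult scaleR_scaleR)
  moreover have eq: "?K = (\<lambda>u. of_real (r * exp u) * F (r * exp u))"
    using \<open>r > 0\<close> by (auto simp: scaleR_conv_of_real)
  ultimately show int: "integrable lborel (\<lambda>u. of_real (r * exp u) * F (r * exp u))"
    by metis
  have "integral {0<..} ?G = (LINT x:{0<..}|lborel. F x)"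
    using set_borel_integral_eq_integral(2)[OF F] by (auto intro!: integral_cong)
  moreover have "integral UNIV ?K = (LINT u|lborel. ?K u)"
    using int unfolding eq[symmetric]
    by (subst set_borel_integral_eq_integral(2)[symmetric]) (auto simp: set_integrable_def set_lebesgue_integral_def)
  ultimately show "(LINT u|lborel. of_real (r * exp u) * F (r * exp u)) = (LINT x:{0<..}|lborel. F x)"
    using \<open>_ \<and> _\<close> unfolding eq by simp
qed

text \<open>In the variable \<open>u = ln (x / r)\<close> the assumptions say that
  \<open>x powr \<rho> * h x\<close> is integrable, bounded, and continuous at the origin: the
  inputs of Fubini's theorem and of the Fejer kernel.\<close>

locale mellin_inversion =
  fixes h :: "real \<Rightarrow> complex" and \<rho> r :: real
  assumes measurable_h [measurable]: "h \<in> borel_measurable borel"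
    and integrable_h: "set_integrable lborel {0<..} (\<lambda>x. of_real (x powr (\<rho> - 1)) * h x)"
    and bounded_h: "\<exists>B. \<forall>x>0. x powr \<rho> * norm (h x) \<le> B"
    and r_pos: "r > 0" and isCont_h: "isCont h r"
begin

text \<open>The function \<open>h\<close> on the additive line, weighted for the line
  \<open>Re s = \<rho>\<close> and centred at the point of inversion. No power of \<open>r\<close>
  appears, since the factor \<open>of_real r powr (- s)\<close> of the inversion integral cancels
  it.\<close>

definition g :: "real \<Rightarrow> complex" where
  "g u = of_real (exp (\<rho> * u)) * h (r * exp u)"

lemma measurable_g [measurable]: "g \<in> borel_measurable borel"
  unfolding g_def by measurable

lemma powr_line:
  fixes s :: complex
  shows "of_real r powr (- s) * (of_real (r * exp u) * of_real (r * exp u) powr (s - 1)) = exp (s * of_real u)"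
proof -
  have "of_real (r * exp u) * of_real (r * exp u) powr (s - 1) = complex_of_real (r * exp u) powr s"
    using r_pos by (subst powr_diff) auto
  also have "\<dots> = of_real r powr s * exp (s * of_real u)"
    using r_pos by (simp add: powr_def Ln_of_real exp_add[symmetric] ring_distribs ln_mult flip: of_real_mult)
  finally show ?thesis
    using r_pos by (simp add: powr_minus)
qed

lemma integrable_g: "integrable lborel g"
proof -
  have "integrable lborel (\<lambda>u. of_real r powr (- of_real \<rho>) * (of_real (r * exp u) * (of_real ((r * exp u) powr (\<rho> - 1)) * h (r * exp u))))"
    by (intro integrable_mult_right integrable_exp_substitution integrable_h r_pos)
  also have "(\<lambda>u. of_real r powr (- of_real \<rho>) * (of_real (r * exp u) * (of_real ((r * exp u) powr (\<rho> - 1)) * h (r * exp u)))) = g"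
  proof
    fix u
    show "of_real r powr (- of_real \<rho>) * (of_real (r * exp u) * (of_real ((r * exp u) powr (\<rho> - 1)) * h (r * exp u))) = g u"
    proof -
      have "complex_of_real ((r * exp u) powr (\<rho> - 1)) = of_real (r * exp u) powr (of_real \<rho> - 1)"
        using powr_of_real[of "r * exp u" "\<rho> - 1"] r_pos by simp
      moreover have "exp (of_real \<rho> * of_real u) = complex_of_real (exp (\<rho> * u))"
        by (simp add: exp_of_real flip: of_real_mult)
      ultimately show ?thesis
        using powr_line[of "of_real \<rho>" u] unfolding g_def by (metis mult.assoc)
    qed
  qed
  finally show ?thesis .
qed

lemma bounded_g: "\<exists>B. \<forall>u. norm (g u) \<le> B"
proof -
  from bounded_h obtain B where B: "\<And>x. x > 0 \<Longrightarrow> x powr \<rho> * norm (h x) \<le> B" by blast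
  have "norm (g u) \<le> r powr (- \<rho>) * B" for u
  proof -
    have "norm (g u) = r powr (- \<rho>) * ((r * exp u) powr \<rho> * norm (h (r * exp u)))"
      using r_pos by (simp add: g_def norm_mult powr_mult powr_minus exp_powr_real mult.commute)
    also have "\<dots> \<le> r powr (- \<rho>) * B"
      using r_pos by (intro mult_left_mono B) auto
    finally show ?thesis .
  qed
  then show ?thesis by blast
qed

lemma isCont_g: "isCont g 0"
proof -
  have "isCont (\<lambda>u. h (r * exp u)) 0"
    using isCont_h by (intro isCont_o2[of 0 "\<lambda>u. r * exp u" h]) simp_all
  then show ?thesis
    unfolding g_def by (intro isCont_mult) simp_all
qed

lemma g_0: "g 0 = h r"
  by (simp add: g_def)

lemma mellin_line_eq_fourier:
  "of_real r powr (- Complex \<rho> y) * mellin h (Complex \<rho> y) =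
   (LINT u|lborel. g u * exp (\<i> * of_real (y * u)))"
proof -
  let ?s = "Complex \<rho> y"
  have int: "set_integrable lborel {0<..} (\<lambda>x. of_real x powr (?s - 1) * h x)"
    unfolding set_integrable_def
  proof (rule Bochner_Integration.integrable_bound[OF integrable_h[unfolded set_integrable_def]])
    show "AE x in lborel. norm (indicator {0<..} x *\<^sub>R (of_real x powr (?s - 1) * h x)) \<le>
       norm (indicator {0<..} x *\<^sub>R (of_real (x powr (\<rho> - 1)) * h x))"
      by (intro AE_I2) (auto simp: indicator_def norm_mult norm_powr_real_powr)
  qed simp
  have "(LINT x:{0<..}|lborel. of_real x powr (?s - 1) * h x) =
      (LINT u|lborel. of_real (r * exp u) * (of_real (r * exp u) powr (?s - 1) * h (r * exp u)))"
    by (rule integral_exp_substitution[OF int r_pos, symmetric])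
  then have "of_real r powr (- ?s) * mellin h ?s =
      (LINT u|lborel. (of_real r powr (- ?s) * (of_real (r * exp u) * of_real (r * exp u) powr (?s - 1))) * h (r * exp u))"
    unfolding mellin_eq_integral_pos
    by (simp only: mult.assoc integral_mult_right_zero)
  also have "\<dots> = (LINT u|lborel. g u * exp (\<i> * of_real (y * u)))"
  proof (intro Bochner_Integration.integral_cong refl)
    fix u
    have "exp (?s * of_real u) = of_real (exp (\<rho> * u)) * exp (\<i> * of_real (y * u))"
      by (simp add: Complex_eq exp_add exp_of_real ring_distribs mult.assoc flip: of_real_mult)
    then show "(of_real r powr (- ?s) * (of_real (r * exp u) * of_real (r * exp u) powr (?s - 1))) * h (r * exp u)
       = g u * exp (\<i> * of_real (y * u))"
      unfolding powr_line g_def by (simp add: mult_ac)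
  qed
  finally show ?thesis .
qed

text \<open>For \<open>T > 0\<close> this is the value of the truncated inversion integral. It does
  not refer to \<open>H\<close>, hence ignores exceptional sets, and it is continuous on the whole
  line, as the Cesaro lemma requires.\<close>

definition dirichlet_mean :: "real \<Rightarrow> complex" where
  "dirichlet_mean T = (LINT u|lborel. g u * of_real (dirichlet T u))"

lemma continuous_dirichlet_mean: "continuous_on UNIV dirichlet_mean"
proof (rule lipschitz_on_continuous_on[of "(LINT u|lborel. norm (g u)) / pi"], rule lipschitz_onI)
  fix T S :: real
  have int: "integrable lborel (\<lambda>u. g u * of_real (dirichlet T u))" for T
  proof (rule Bochner_Integration.integrable_bound)
    show "integrable lborel (\<lambda>u. norm (g u) * (\<bar>T\<bar> / pi))"
      using integrable_norm[OF integrable_g] by simp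
    have "norm (g u) * \<bar>dirichlet T u\<bar> \<le> norm (g u) * (\<bar>T\<bar> / pi)" for u
      by (intro mult_left_mono abs_dirichlet_le) auto
    then show "AE u in lborel. norm (g u * of_real (dirichlet T u)) \<le> norm (norm (g u) * (\<bar>T\<bar> / pi))"
      by (intro AE_I2) (simp add: norm_mult)
  qed measurable
  have "dist (dirichlet_mean T) (dirichlet_mean S) =
      norm (LINT u|lborel. g u * of_real (dirichlet T u - dirichlet S u))"
    unfolding dirichlet_mean_def dist_norm using int
    by (simp add: algebra_simps flip: Bochner_Integration.integral_diff)
  also have "\<dots> \<le> (LINT u|lborel. norm (g u) * (\<bar>T - S\<bar> / pi))"
  proof (rule Bochner_Integration.integral_norm_bound_integral)
    show "integrable lborel (\<lambda>u. g u * of_real (dirichlet T u - dirichlet S u))"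
      using Bochner_Integration.integrable_diff[OF int[of T] int[of S]] by (simp add: algebra_simps)
    show "norm (g u * of_real (dirichlet T u - dirichlet S u)) \<le> norm (g u) * (\<bar>T - S\<bar> / pi)" for u
    proof -
      have "norm (g u) * \<bar>dirichlet T u - dirichlet S u\<bar> \<le> norm (g u) * (\<bar>T - S\<bar> / pi)"
        by (intro mult_left_mono abs_dirichlet_diff_le) auto
      then show ?thesis by (simp only: norm_mult norm_of_real)
    qed
  qed (use integrable_norm[OF integrable_g] in simp)
  also have "\<dots> = (LINT u|lborel. norm (g u)) / pi * dist T S"
    by (simp add: dist_real_def)
  finally show "dist (dirichlet_mean T) (dirichlet_mean S) \<le> (LINT u|lborel. norm (g u)) / pi * dist T S" .
qed simp

lemma fejer_mean_tendsto:
  "((\<lambda>T. of_real (1 / T) * integral {0..T} dirichlet_mean) \<longlongrightarrow> h r) at_top"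
proof (rule Lim_transform_eventually)
  from bounded_g obtain B where "\<And>u. norm (g u) \<le> B" by blast
  then show "((\<lambda>T. LINT u|lborel. g u * of_real (T * fejer (T * u))) \<longlongrightarrow> h r) at_top"
    using fejer_approximate_identity[of g B] isCont_g by (simp add: g_0)
  show "\<forall>\<^sub>F T in at_top. (LINT u|lborel. g u * of_real (T * fejer (T * u))) = of_real (1 / T) * integral {0..T} dirichlet_mean"
    using eventually_gt_at_top[of 0]
  proof eventually_elim
    case (elim T)
    have bd: "norm (complex_of_real (dirichlet y u)) \<le> T / pi" if "y \<in> {0..T}" for y u
    proof -
      have "\<bar>dirichlet y u\<bar> \<le> \<bar>y\<bar> / pi" by (rule abs_dirichlet_le)
      also have "\<dots> \<le> T / pi" using that by (intro divide_right_mono) auto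
      finally show ?thesis by simp
    qed
    have meas: "case_prod (\<lambda>y u. complex_of_real (dirichlet y u)) \<in> borel_measurable (borel \<Otimes>\<^sub>M borel)"
      using measurable_compose[OF dirichlet_measurable borel_measurable_of_real]
      by (simp add: case_prod_beta)
    have "integral {0..T} dirichlet_mean = (LINT y:{0..T}|lborel. dirichlet_mean y)"
      unfolding dirichlet_mean_def
      by (intro set_borel_integral_eq_integral(2)[symmetric] set_integrable_bounded_kernel[OF integrable_g meas bd])
    also have "\<dots> = (LINT u|lborel. g u * (LINT y:{0..T}|lborel. complex_of_real (dirichlet y u)))"
      unfolding dirichlet_mean_def
      by (rule Fubini_bounded_kernel[OF integrable_g meas bd])
    \<comment> \<open>The point \<open>u = 0\<close> is discarded because there
      \<open>fejer 0 = 0\<close> is not the mean of the Dirichlet kernels.\<close>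
    also have "\<dots> = (LINT u|lborel. g u * of_real (T * (T * fejer (T * u))))"
      by (rule integral_discrete_difference[where X = "{0}"]) (use elim in \<open>auto simp: integral_dirichlet\<close>)
    also have "\<dots> = of_real T * (LINT u|lborel. g u * of_real (T * fejer (T * u)))"
      by (subst integral_mult_right_zero[symmetric]) (simp add: mult_ac)
    finally show ?case using elim by simp
  qed
qed

lemma inv_mellin_trunc_eq:
  fixes Z :: "real set" and T :: real
  assumes H: "\<And>y. y \<notin> Z \<Longrightarrow> H (Complex \<rho> y) = mellin h (Complex \<rho> y)" and Z: "countable Z"
    and "T > 0"
  shows "inv_mellin_trunc \<rho> H r T = dirichlet_mean T"
proof -
  have meas: "case_prod (\<lambda>y u. exp (\<i> * complex_of_real (y * u))) \<in> borel_measurable (borel \<Otimes>\<^sub>M borel)"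
    unfolding borel_prod by (auto intro!: borel_measurable_continuous_onI continuous_intros simp: case_prod_beta)
  have bd: "norm (exp (\<i> * complex_of_real (y * u))) \<le> 1" for y u
    by simp
  have "contour_integral (linepath (Complex \<rho> (-T)) (Complex \<rho> T)) (\<lambda>s. of_real r powr (-s) * H s) =
     \<i> * integral {-T..T} (\<lambda>y. of_real r powr (- Complex \<rho> y) * H (Complex \<rho> y))"
    using \<open>T > 0\<close> by (intro contour_integral_linepath_same_Re) auto
  \<comment> \<open>A gauge integral ignores the negligible set \<open>Z\<close>, so
    \<open>H\<close> may be replaced by the exact Mellin transform, whatever its values on
    \<open>Z\<close>.\<close>
  also have "integral {-T..T} (\<lambda>y. of_real r powr (- Complex \<rho> y) * H (Complex \<rho> y)) =
     integral {-T..T} (\<lambda>y. LINT u|lborel. g u * exp (\<i> * of_real (y * u)))"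
    by (rule integral_spike[of Z]) (use H Z in \<open>auto simp: mellin_line_eq_fourier negligible_iff_null_sets countable_imp_null_set_lborel null_sets_completionI\<close>)
  also have "\<dots> = (LINT y:{-T..T}|lborel. LINT u|lborel. g u * exp (\<i> * of_real (y * u)))"
    by (intro set_borel_integral_eq_integral(2)[symmetric] set_integrable_bounded_kernel[OF integrable_g meas bd])
  also have "\<dots> = (LINT u|lborel. g u * (LINT y:{-T..T}|lborel. exp (\<i> * of_real (y * u))))"
    by (rule Fubini_bounded_kernel[OF integrable_g meas bd])
  also have "\<dots> = 2 * of_real pi * dirichlet_mean T"
    unfolding dirichlet_mean_def integral_exp_dirichlet[OF less_imp_le[OF \<open>T > 0\<close>]]
    by (simp add: mult_ac flip: integral_mult_right_zero)
  finally show ?thesis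
    by (simp add: inv_mellin_trunc_def)
qed

theorem has_inv_mellin_C1:
  assumes "\<And>y. y \<notin> Z \<Longrightarrow> H (Complex \<rho> y) = mellin h (Complex \<rho> y)" "countable Z"
  shows "has_inv_mellin_C1 \<rho> H r (h r)"
proof -
  have "integral {0..T} (inv_mellin_trunc \<rho> H r) = integral {0..T} dirichlet_mean" for T
    by (rule integral_spike[of "{0}"]) (auto intro!: inv_mellin_trunc_eq[OF assms, symmetric])
  then show ?thesis
    unfolding has_inv_mellin_C1_def using fejer_mean_tendsto by simp
qed

text \<open>Ordinary convergence forces the means to the same limit, and the means are already known
  to tend to \<open>h r\<close>.\<close>

theorem has_inv_mellin_unique:
  assumes "\<And>y. y \<notin> Z \<Longrightarrow> H (Complex \<rho> y) = mellin h (Complex \<rho> y)" "countable Z"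
    and "has_inv_mellin \<rho> H r v"
  shows "v = h r"
proof -
  have "(dirichlet_mean \<longlongrightarrow> v) at_top"
  proof (rule Lim_transform_eventually)
    show "(inv_mellin_trunc \<rho> H r \<longlongrightarrow> v) at_top"
      using assms(3) by (simp add: has_inv_mellin_def)
    show "\<forall>\<^sub>F T in at_top. inv_mellin_trunc \<rho> H r T = dirichlet_mean T"
      using eventually_gt_at_top[of 0] by eventually_elim (rule inv_mellin_trunc_eq[OF assms(1,2)])
  qed
  from cesaro_mean_tendsto[OF continuous_dirichlet_mean this] show ?thesis
    using fejer_mean_tendsto by (intro tendsto_unique[of at_top]) auto
qed

end

section \<open>Mellin transforms of superpositions of dilations\<close>

lemma mellin_rescale:
  fixes F :: "real \<Rightarrow> complex"
  assumes "c > 0"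
  shows "(LINT x:{0<..}|lborel. of_real x powr (s - 1) * F (x * c)) = of_real c powr (- s) * mellin F s"
proof -
  have "mellin F s = (LINT y|lborel. indicator {0<..} y *\<^sub>R (of_real y powr (s - 1) * F y))"
    by (simp add: mellin_eq_integral_pos set_lebesgue_integral_def)
  also have "\<dots> = c *\<^sub>R (LINT x|lborel. indicator {0<..} (c * x) *\<^sub>R (of_real (c * x) powr (s - 1) * F (c * x)))"
    using assms by (subst lborel_integral_real_affine[of c _ 0]) auto
  also have "\<dots> = (LINT x|lborel. of_real c powr s * (indicator {0<..} x *\<^sub>R (of_real x powr (s - 1) * F (x * c))))"
    unfolding integral_scaleR_right[symmetric]
  proof (intro Bochner_Integration.integral_cong refl)
    fix x :: real
    show "c *\<^sub>R (indicator {0<..} (c * x) *\<^sub>R (of_real (c * x) powr (s - 1) * F (c * x))) =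
      of_real c powr s * (indicator {0<..} x *\<^sub>R (of_real x powr (s - 1) * F (x * c)))"
    proof (cases "x > 0")
      case True
      have "of_real c * of_real (c * x) powr (s - 1) = of_real c powr s * complex_of_real x powr (s - 1)"
        using assms True by (simp add: powr_times_real_left powr_diff)
      then have "of_real c * (of_real (c * x) powr (s - 1) * F (c * x)) =
          of_real c powr s * (of_real x powr (s - 1) * F (x * c))"
        by (metis mult.assoc mult.commute)
      then show ?thesis
        using assms True by (simp add: scaleR_conv_of_real)
    next
      case False
      then show ?thesis using assms by (simp add: zero_less_mult_iff)
    qed
  qed
  also have "\<dots> = of_real c powr s * (LINT x:{0<..}|lborel. of_real x powr (s - 1) * F (x * c))"
    by (simp only: set_lebesgue_integral_def integral_mult_right_zero)
  finally show ?thesis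
    using assms by (simp add: powr_minus)
qed

text \<open>The Mellin transform diagonalises dilations, so each \<open>t\<close> contributes a
  factor \<open>of_real (c t) powr (- s)\<close>. The majorant \<open>M\<close> is common to all
  \<open>F t\<close>; hence the inner integral of norms is at most
  \<open>norm (w t) * c t powr (- Re s)\<close> times one constant \<open>Q\<close>, and
  \<open>w_int\<close> is the integrability of this bound. Both Mellin transforms of the line
  integrals are instances.\<close>

lemma mellin_superposition:
  fixes w :: "real \<Rightarrow> complex" and c M :: "real \<Rightarrow> real" and F :: "real \<Rightarrow> real \<Rightarrow> complex"
  assumes [measurable]: "w \<in> borel_measurable borel" "c \<in> borel_measurable borel"
      "case_prod F \<in> borel_measurable (borel \<Otimes>\<^sub>M borel)"
    and c_pos: "\<And>t. t > 0 \<Longrightarrow> c t > 0"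
    and w_int: "set_integrable lborel {0<..} (\<lambda>t. norm (w t) * c t powr (- Re s))"
    and dom: "\<And>t x. t > 0 \<Longrightarrow> x > 0 \<Longrightarrow> norm (F t x) \<le> M x"
    and M_int: "set_integrable lborel {0<..} (\<lambda>x. x powr (Re s - 1) * M x)"
  shows "mellin (\<lambda>x. LINT t:{0<..}|lborel. w t * F t (x * c t)) s =
     (LINT t:{0<..}|lborel. w t * of_real (c t) powr (- s) * mellin (F t) s)"
proof -
  let ?f = "\<lambda>t x. indicator {0<..} t *\<^sub>R (indicator {0<..} x *\<^sub>R (w t * (of_real x powr (s - 1) * F t (x * c t))))"
  let ?\<sigma> = "Re s"
  let ?m = "\<lambda>x. indicator {0<..} x *\<^sub>R (x powr (?\<sigma> - 1) * M x)"
  define Q where "Q = (LINT x|lborel. ?m x)"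
  have F_comp [measurable]: "(\<lambda>(t, x). F t (x * c t)) \<in> borel_measurable (borel \<Otimes>\<^sub>M borel)"
  proof -
    have "(\<lambda>z. case_prod F ((\<lambda>(t, x). (t, x * c t)) z)) \<in> borel_measurable (borel \<Otimes>\<^sub>M borel)"
      by (rule measurable_compose[of _ _ "borel \<Otimes>\<^sub>M borel"]) measurable
    then show ?thesis by (simp add: case_prod_beta)
  qed
  have F_meas [measurable]: "(\<lambda>x. F t (x * c t)) \<in> borel_measurable borel" for t
    using measurable_compose[OF measurable_Pair1'[of t borel borel] F_comp] by simp
  have meas: "case_prod ?f \<in> borel_measurable (lborel \<Otimes>\<^sub>M lborel)"
    using F_comp by (simp add: case_prod_beta) measurable
  have scaled: "has_bochner_integral lborel (\<lambda>x. indicator {0<..} x *\<^sub>R (x powr (?\<sigma> - 1) * M (c t * x))) (c t powr (- ?\<sigma>) * Q)"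
    if "t > 0" for t
  proof -
    have "c t > 0" using that by (rule c_pos)
    have "has_bochner_integral lborel ?m Q"
      using M_int by (simp add: Q_def has_bochner_integral_iff set_integrable_def)
    then have "has_bochner_integral lborel (\<lambda>x. ?m (c t * x)) (Q /\<^sub>R \<bar>c t\<bar>)"
      using lborel_has_bochner_integral_real_affine_iff[of "c t" ?m Q 0] \<open>c t > 0\<close> by simp
    \<comment> \<open>The factor \<open>c t powr (1 - ?\<sigma>)\<close> turns
      \<open>(c t * x) powr (?\<sigma> - 1)\<close> back into \<open>x powr (?\<sigma> - 1)\<close>;
      together with the Jacobian it leaves \<open>c t powr (- ?\<sigma>)\<close>.\<close>
    then have "has_bochner_integral lborel (\<lambda>x. (c t powr (1 - ?\<sigma>)) * ?m (c t * x)) (c t powr (1 - ?\<sigma>) * (Q /\<^sub>R \<bar>c t\<bar>))"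
      by (rule has_bochner_integral_mult_right)
    moreover have "c t powr (1 - ?\<sigma>) * (Q /\<^sub>R \<bar>c t\<bar>) = c t powr (- ?\<sigma>) * Q"
      using \<open>c t > 0\<close> by (simp add: powr_diff powr_minus field_simps)
    moreover have "c t powr (1 - ?\<sigma>) * ?m (c t * x) = indicator {0<..} x *\<^sub>R (x powr (?\<sigma> - 1) * M (c t * x))" for x
    proof (cases "x > 0")
      case True
      then show ?thesis using \<open>c t > 0\<close> by (simp add: powr_mult powr_diff field_simps)
    next
      case False
      then show ?thesis using \<open>c t > 0\<close> by (simp add: zero_less_mult_iff)
    qed
    ultimately show ?thesis by (simp only:)
  qed
  have bound: "norm (?f t x) \<le> norm (w t) * (indicator {0<..} x *\<^sub>R (x powr (?\<sigma> - 1) * M (c t * x)))" if "t > 0" for t x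
  proof (cases "x > 0")
    case True
    have "norm (F t (x * c t)) \<le> M (c t * x)"
      using dom[of t "x * c t"] c_pos[OF that] that True by (simp add: mult.commute)
    then have "norm (w t) * (x powr (?\<sigma> - 1) * norm (F t (x * c t))) \<le> norm (w t) * (x powr (?\<sigma> - 1) * M (c t * x))"
      by (intro mult_left_mono) auto
    then show ?thesis
      using True that by (simp add: norm_mult norm_powr_real_powr)
  qed simp
  have int_x: "integrable lborel (\<lambda>x. ?f t x)" for t
  proof (cases "t > 0")
    case True
    show ?thesis
    proof (rule Bochner_Integration.integrable_bound)
      show "integrable lborel (\<lambda>x. norm (w t) * (indicator {0<..} x *\<^sub>R (x powr (?\<sigma> - 1) * M (c t * x))))"
        using scaled[OF True] by (intro integrable_mult_right) (simp add: has_bochner_integral_iff)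
      show "AE x in lborel. norm (?f t x) \<le> norm (norm (w t) * (indicator {0<..} x *\<^sub>R (x powr (?\<sigma> - 1) * M (c t * x))))"
        using bound[OF True] by (intro AE_I2) (metis abs_ge_self order_trans real_norm_def)
    qed measurable
  qed simp
  have int: "integrable (lborel \<Otimes>\<^sub>M lborel) (case_prod ?f)"
  proof (rule lborel_pair.Fubini_integrable[OF meas])
    show "AE t in lborel. integrable lborel (\<lambda>x. case_prod ?f (t, x))"
      using int_x by (intro AE_I2) simp
    show "integrable lborel (\<lambda>t. LINT x|lborel. norm (case_prod ?f (t, x)))"
    proof (rule Bochner_Integration.integrable_bound)
      show "integrable lborel (\<lambda>t. (indicator {0<..} t *\<^sub>R (norm (w t) * c t powr (- ?\<sigma>))) * Q)"
        using w_int by (intro integrable_mult_left) (simp add: set_integrable_def)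
      show "(\<lambda>t. LINT x|lborel. norm (case_prod ?f (t, x))) \<in> borel_measurable lborel"
        using meas by (intro lborel.borel_measurable_lebesgue_integral) (simp add: case_prod_beta)
      show "AE t in lborel. norm (LINT x|lborel. norm (case_prod ?f (t, x))) \<le>
          norm ((indicator {0<..} t *\<^sub>R (norm (w t) * c t powr (- ?\<sigma>))) * Q)"
      proof (intro AE_I2)
        fix t :: real
        show "norm (LINT x|lborel. norm (case_prod ?f (t, x))) \<le>
          norm ((indicator {0<..} t *\<^sub>R (norm (w t) * c t powr (- ?\<sigma>))) * Q)"
        proof (cases "t > 0")
          case True
          have "(LINT x|lborel. norm (?f t x)) \<le>
             (LINT x|lborel. norm (w t) * (indicator {0<..} x *\<^sub>R (x powr (?\<sigma> - 1) * M (c t * x))))"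
            using scaled[OF True]
            by (intro integral_mono integrable_norm int_x integrable_mult_right bound[OF True])
               (simp add: has_bochner_integral_iff)
          also have "\<dots> = norm (w t) * (c t powr (- ?\<sigma>) * Q)"
            using scaled[OF True] by (simp only: integral_mult_right_zero has_bochner_integral_iff)
          finally show ?thesis
            using True by (simp add: mult.assoc)
        qed simp
      qed
    qed
  qed
  have "mellin (\<lambda>x. LINT t:{0<..}|lborel. w t * F t (x * c t)) s = (LINT x|lborel. LINT t|lborel. ?f t x)"
    unfolding mellin_eq_integral_pos set_lebesgue_integral_def
    by (simp add: mult_ac flip: integral_mult_right_zero integral_scaleR_right)
  also have "\<dots> = (LINT t|lborel. LINT x|lborel. ?f t x)"
    by (rule lborel_pair.Fubini_integral[OF int])
  also have "\<dots> = (LINT t:{0<..}|lborel. w t * of_real (c t) powr (- s) * mellin (F t) s)"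
    unfolding set_lebesgue_integral_def
  proof (intro Bochner_Integration.integral_cong refl)
    fix t :: real
    have "(LINT x|lborel. ?f t x) = indicator {0<..} t *\<^sub>R (w t * (LINT x:{0<..}|lborel. of_real x powr (s - 1) * F t (x * c t)))"
      unfolding set_lebesgue_integral_def
      by (simp add: mult_ac flip: integral_mult_right_zero integral_scaleR_right)
    also have "\<dots> = indicator {0<..} t *\<^sub>R (w t * of_real (c t) powr (- s) * mellin (F t) s)"
      using mellin_rescale[OF c_pos, of t s "F t"] by (cases "t > 0") simp_all
    finally show "(LINT x|lborel. ?f t x) = indicator {0<..} t *\<^sub>R (w t * of_real (c t) powr (- s) * mellin (F t) s)" .
  qed
  finally show ?thesis .
qed

section \<open>Zeros of the kernel\<close>

lemma norm_exp_minus_one_le: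
  fixes z :: complex
  shows "norm (exp z - 1) \<le> norm z * exp (norm z)"
proof -
  have "norm (exp z - exp 0) \<le> exp (norm z) * norm (z - 0)"
  proof (rule field_differentiable_bound[of "cball 0 (norm z)" exp exp])
    fix w :: complex assume "w \<in> cball 0 (norm z)"
    then show "norm (exp w) \<le> exp (norm z)"
      using norm_exp[of w] by (simp add: order_trans)
  qed (auto intro!: derivative_eq_intros)
  then show ?thesis by (simp add: mult.commute)
qed

text \<open>Differentiation under the integral sign. The open half plane leaves room to move left by
  \<open>2 * \<epsilon>\<close>: one \<open>\<epsilon>\<close> absorbs the exponential in the
  difference quotient, the other the factor \<open>\<phi> t\<close> that differentiation
  produces.\<close>

lemma holomorphic_laplace:
  fixes k :: "real \<Rightarrow> complex" and \<phi> :: "real \<Rightarrow> real"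
  assumes [measurable]: "k \<in> borel_measurable borel" "\<phi> \<in> borel_measurable borel"
    and \<phi>: "\<And>t. \<phi> t \<ge> 0"
    and int: "\<And>\<zeta>. Re \<zeta> > c \<Longrightarrow> integrable lborel (\<lambda>t. k t * exp (- \<zeta> * of_real (\<phi> t)))"
  shows "(\<lambda>\<zeta>. LINT t|lborel. k t * exp (- \<zeta> * of_real (\<phi> t))) holomorphic_on {\<zeta>. Re \<zeta> > c}"
proof (rule holomorphic_onI, clarify)
  fix \<zeta> :: complex assume "Re \<zeta> > c"
  \<comment> \<open>A third of the distance to the boundary, so that
    \<open>\<zeta> - 2 * \<epsilon>\<close> stays strictly inside the half plane.\<close>
  define \<epsilon> where "\<epsilon> = (Re \<zeta> - c) / 3"
  have \<epsilon>: "\<epsilon> > 0" "c < Re (\<zeta> - 2 * of_real \<epsilon>)"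
    using \<open>Re \<zeta> > c\<close> by (auto simp: \<epsilon>_def field_simps)
  let ?f = "\<lambda>\<zeta> t. k t * exp (- \<zeta> * of_real (\<phi> t))"
  let ?F = "\<lambda>\<zeta>. LINT t|lborel. ?f \<zeta> t"
  let ?f' = "\<lambda>t. - of_real (\<phi> t) * ?f \<zeta> t"
  have "(\<lambda>h. (?F (\<zeta> + h) - ?F \<zeta>) / h) \<midarrow>0\<rightarrow> (LINT t|lborel. ?f' t)"
    unfolding tendsto_at_iff_sequentially comp_def
  proof (intro allI impI)
    fix X :: "nat \<Rightarrow> complex"
    assume "\<forall>i. X i \<in> UNIV - {0}" and X: "X \<longlonglongrightarrow> 0"
    then have X0: "X i \<noteq> 0" for i by simp
    have ev: "eventually (\<lambda>i. norm (X i) < \<epsilon>) sequentially"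
      using order_tendstoD(2)[OF tendsto_norm_zero[OF X] \<epsilon>(1)] .
    then obtain N where N: "\<And>i. i \<ge> N \<Longrightarrow> norm (X i) < \<epsilon>"
      by (auto simp: eventually_sequentially)
    \<comment> \<open>Dropping the first \<open>N\<close> terms gives
      \<open>norm (X (i + N)) < \<epsilon>\<close> for every \<open>i\<close>, since dominated
      convergence asks for a bound at every index.\<close>
    let ?q = "\<lambda>i t. (?f (\<zeta> + X (i + N)) t - ?f \<zeta> t) / X (i + N)"
    have q: "?q i t = ?f \<zeta> t * ((exp (- X (i + N) * of_real (\<phi> t)) - 1) / X (i + N))" for i t
      by (simp add: exp_add[symmetric] ring_distribs diff_divide_distrib)
    have "(\<lambda>i. LINT t|lborel. ?q i t) \<longlonglongrightarrow> (LINT t|lborel. ?f' t)"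
    proof (rule integral_dominated_convergence)
      show "integrable lborel (\<lambda>t. norm (?f (\<zeta> - 2 * of_real \<epsilon>) t) / \<epsilon>)"
        using integrable_norm[OF int[OF \<epsilon>(2)]] by simp
      show "AE t in lborel. (\<lambda>i. ?q i t) \<longlonglongrightarrow> ?f' t"
      proof (intro AE_I2)
        fix t
        have "((\<lambda>z. exp (- z * of_real (\<phi> t))) has_field_derivative (- of_real (\<phi> t))) (at (0::complex))"
          by (auto intro!: derivative_eq_intros)
        then have "(\<lambda>z. (exp (- z * of_real (\<phi> t)) - 1) / z) \<midarrow>0\<rightarrow> (- of_real (\<phi> t) :: complex)"
          by (simp add: has_field_derivative_iff)
        moreover have "filterlim (\<lambda>i. X (i + N)) (at 0) sequentially"
          using LIMSEQ_ignore_initial_segment[OF X, of N] X0 by (simp add: filterlim_at)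
        ultimately have "(\<lambda>i. (exp (- X (i + N) * of_real (\<phi> t)) - 1) / X (i + N)) \<longlonglongrightarrow> - of_real (\<phi> t)"
          by (rule filterlim_compose)
        from tendsto_mult_left[OF this, of "?f \<zeta> t"] show "(\<lambda>i. ?q i t) \<longlonglongrightarrow> ?f' t"
          unfolding q by (simp add: mult_ac)
      qed
      show "AE t in lborel. norm (?q i t) \<le> norm (?f (\<zeta> - 2 * of_real \<epsilon>) t) / \<epsilon>" for i
      proof (intro AE_I2)
        fix t
        have Xi: "norm (X (i + N)) \<le> \<epsilon>" using N[of "i + N"] by simp
        have "norm (exp (- X (i + N) * of_real (\<phi> t)) - 1) \<le> norm (X (i + N)) * \<phi> t * exp (norm (X (i + N)) * \<phi> t)"
          using norm_exp_minus_one_le[of "- X (i + N) * of_real (\<phi> t)"] \<phi>[of t]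
          by (simp add: norm_mult)
        also have "\<dots> \<le> norm (X (i + N)) * \<phi> t * exp (\<epsilon> * \<phi> t)"
          using Xi \<phi>[of t] by (intro mult_left_mono) (auto intro!: mult_right_mono)
        finally have "norm ((exp (- X (i + N) * of_real (\<phi> t)) - 1) / X (i + N)) \<le> \<phi> t * exp (\<epsilon> * \<phi> t)"
          using X0[of "i + N"] by (simp add: norm_divide field_simps)
        also have "\<phi> t \<le> exp (\<epsilon> * \<phi> t) / \<epsilon>"
        proof -
          have "\<epsilon> * \<phi> t \<le> exp (\<epsilon> * \<phi> t)"
            using exp_ge_add_one_self[of "\<epsilon> * \<phi> t"] by linarith
          then show ?thesis using \<epsilon>(1) by (simp add: pos_le_divide_eq mult.commute)
        qed
        then have "\<phi> t * exp (\<epsilon> * \<phi> t) \<le> exp (\<epsilon> * \<phi> t) / \<epsilon> * exp (\<epsilon> * \<phi> t)"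
          by (intro mult_right_mono) auto
        also have "\<dots> = exp (2 * \<epsilon> * \<phi> t) / \<epsilon>"
          by (simp add: exp_add[symmetric])
        finally have "norm (?q i t) \<le> norm (?f \<zeta> t) * (exp (2 * \<epsilon> * \<phi> t) / \<epsilon>)"
          unfolding q norm_mult[of "?f \<zeta> t"] by (intro mult_left_mono) auto
        also have "\<dots> = norm (?f (\<zeta> - 2 * of_real \<epsilon>) t) / \<epsilon>"
          by (simp add: norm_mult exp_add[symmetric] ring_distribs)
        finally show "norm (?q i t) \<le> norm (?f (\<zeta> - 2 * of_real \<epsilon>) t) / \<epsilon>" .
      qed
    qed measurable
    moreover have "(LINT t|lborel. ?q i t) = (?F (\<zeta> + X (i + N)) - ?F \<zeta>) / X (i + N)" for i
    proof -
      have "\<bar>Re (X (i + N))\<bar> < \<epsilon>"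
        using abs_Re_le_cmod[of "X (i + N)"] N[of "i + N"] by linarith
      then have "Re (\<zeta> + X (i + N)) > c"
        using \<epsilon> by auto
      from int[OF this] int[OF \<open>Re \<zeta> > c\<close>] show ?thesis by simp
    qed
    ultimately have "(\<lambda>i. (?F (\<zeta> + X (i + N)) - ?F \<zeta>) / X (i + N)) \<longlonglongrightarrow> (LINT t|lborel. ?f' t)"
      by (simp only:)
    then show "(\<lambda>i. (?F (\<zeta> + X i) - ?F \<zeta>) / X i) \<longlonglongrightarrow> (LINT t|lborel. ?f' t)"
      by (rule LIMSEQ_offset)
  qed
  then have "(?F has_field_derivative (LINT t|lborel. ?f' t)) (at \<zeta>)"
    by (simp only: DERIV_def)
  then show "?F field_differentiable at \<zeta> within {\<zeta>. c < Re \<zeta>}"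
    using field_differentiable_at_within field_differentiable_def by blast
qed

text \<open>By the Weierstrass theorem \<open>\<psi>\<close> is a uniform limit of polynomials on
  \<open>{0..1}\<close>. Vanishing moments annihilate polynomials in \<open>p\<close>, and the
  uniform error is multiplied by at most the integral of \<open>norm (w t)\<close>.\<close>

lemma integral_mult_continuous_eq_0:
  fixes w :: "real \<Rightarrow> complex" and p \<psi> :: "real \<Rightarrow> real"
  assumes w: "integrable lborel w" and [measurable]: "p \<in> borel_measurable borel"
    and p01: "\<And>t. p t \<in> {0..1}"
    and moments: "\<And>N::nat. (LINT t|lborel. w t * of_real (p t ^ N)) = 0"
    and \<psi>: "continuous_on {0..1} \<psi>" and [measurable]: "\<psi> \<in> borel_measurable borel"
  shows "(LINT t|lborel. w t * of_real (\<psi> (p t))) = 0"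
proof -
  have [measurable]: "w \<in> borel_measurable borel"
    using borel_measurable_integrable[OF w] by simp
  have int: "integrable lborel (\<lambda>t. w t * of_real (g (p t)))"
    if g: "continuous_on {0..1} g" and [measurable]: "g \<in> borel_measurable borel" for g :: "real \<Rightarrow> real"
  proof -
    from compact_continuous_image[OF g compact_Icc] obtain B where B: "\<And>x. x \<in> {0..1} \<Longrightarrow> \<bar>g x\<bar> \<le> B"
      using compact_imp_bounded bounded_iff by (metis image_eqI real_norm_def)
    show ?thesis
    proof (rule Bochner_Integration.integrable_bound)
      show "integrable lborel (\<lambda>t. norm (w t) * B)"
        using integrable_norm[OF w] by simp
      have "norm (w t) * \<bar>g (p t)\<bar> \<le> norm (w t) * B" for t
        by (intro mult_left_mono B p01) auto
      then show "AE t in lborel. norm (w t * of_real (g (p t))) \<le> norm (norm (w t) * B)"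
        by (intro AE_I2) (simp add: norm_mult order_trans[OF _ abs_ge_self])
    qed measurable
  qed
  define M where "M = (LINT t|lborel. norm (w t))"
  have bd: "norm (LINT t|lborel. w t * of_real (\<psi> (p t))) \<le> M * \<epsilon>" if "0 < \<epsilon>" for \<epsilon>
  proof -
    obtain q where "real_polynomial_function q" and q: "\<And>x. x \<in> {0..1} \<Longrightarrow> \<bar>\<psi> x - q x\<bar> < \<epsilon>"
      using Stone_Weierstrass_real_polynomial_function[OF compact_Icc \<psi> \<open>\<epsilon> > 0\<close>] by blast
    then obtain a n where qsum: "q = (\<lambda>x. \<Sum>i\<le>n. a i * x ^ i)"
      unfolding real_polynomial_function_iff_sum by blast
    have [measurable]: "q \<in> borel_measurable borel"
      unfolding qsum by measurable
    have qc: "continuous_on {0..1} q"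
      unfolding qsum by (intro continuous_intros)
    have "(LINT t|lborel. w t * of_real (q (p t))) = (LINT t|lborel. (\<Sum>i\<le>n. of_real (a i) * (w t * of_real (p t ^ i))))"
      unfolding qsum by (simp add: sum_distrib_left mult_ac)
    also have "\<dots> = (\<Sum>i\<le>n. LINT t|lborel. of_real (a i) * (w t * of_real (p t ^ i)))"
      by (intro Bochner_Integration.integral_sum integrable_mult_right int[of "\<lambda>x. x ^ i" for i] continuous_intros) measurable
    also have "\<dots> = 0"
      by (simp only: integral_mult_right_zero moments mult_zero_right sum.neutral_const)
    finally have "(LINT t|lborel. w t * of_real (\<psi> (p t))) = (LINT t|lborel. w t * of_real (\<psi> (p t) - q (p t)))"
      using int[OF \<psi>] int[OF qc] by (simp add: algebra_simps)
    also have "norm \<dots> \<le> (LINT t|lborel. norm (w t) * \<epsilon>)"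
    proof (rule Bochner_Integration.integral_norm_bound_integral)
      show "integrable lborel (\<lambda>t. w t * of_real (\<psi> (p t) - q (p t)))"
        using Bochner_Integration.integrable_diff[OF int[OF \<psi>] int[OF qc]] by (simp add: algebra_simps)
      have "norm (w t) * \<bar>\<psi> (p t) - q (p t)\<bar> \<le> norm (w t) * \<epsilon>" for t
        by (intro mult_left_mono less_imp_le[OF q] p01) auto
      then show "norm (w t * of_real (\<psi> (p t) - q (p t))) \<le> norm (w t) * \<epsilon>" for t
        by (simp only: norm_mult norm_of_real)
    qed (use integrable_norm[OF w] in simp)
    finally show ?thesis by (simp add: M_def)
  qed
  have "M \<ge> 0" by (simp add: M_def)
  have "norm (LINT t|lborel. w t * of_real (\<psi> (p t))) \<le> 0"
  proof (rule field_le_epsilon)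
    fix e :: real assume "e > 0"
    \<comment> \<open>Dividing by \<open>M + 1\<close> instead of \<open>M\<close> covers the case
      \<open>M = 0\<close>.\<close>
    have "norm (LINT t|lborel. w t * of_real (\<psi> (p t))) \<le> M * (e / (M + 1))"
      using \<open>M \<ge> 0\<close> \<open>e > 0\<close> by (intro bd) auto
    also have "\<dots> \<le> 0 + e"
      using \<open>M \<ge> 0\<close> \<open>e > 0\<close> by (simp add: field_simps)
    finally show "norm (LINT t|lborel. w t * of_real (\<psi> (p t))) \<le> 0 + e" .
  qed
  then show ?thesis by simp
qed

text \<open>Near 0 the factor \<open>t powr (- a)\<close> is integrable because
  \<open>a < 1\<close>; beyond 1 the product is at most \<open>t powr (- a - \<sigma>)\<close>,
  whose exponent is below -1.\<close>

lemma set_integrable_powr_weight: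
  assumes "0 < a" "a < 1" "\<sigma> > 1"
  shows "set_integrable lborel {0<..} (\<lambda>t::real. t powr (- a) * (1 + t\<^sup>2) powr (- \<sigma> / 2))"
proof -
  have "set_integrable lborel {0..1} (\<lambda>t::real. t powr (- a))"
    using assms by (intro set_integrable_lborel_nonneg integrable_on_powr_from_0) auto
  moreover have "set_integrable lborel {1..} (\<lambda>t::real. t powr (- a - \<sigma>))"
    using assms has_integral_powr_to_inf[of "- a - \<sigma>" 1]
    by (intro set_integrable_lborel_nonneg) (auto simp: has_integral_integrable)
  ultimately have "integrable lborel (\<lambda>t::real. indicator {0..1} t *\<^sub>R t powr (- a) + indicator {1..} t *\<^sub>R t powr (- a - \<sigma>))"
    unfolding set_integrable_def by (intro Bochner_Integration.integrable_add)
  then show ?thesis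
    unfolding set_integrable_def
  proof (rule Bochner_Integration.integrable_bound)
    show "AE t in lborel. norm (indicator {0<..} t *\<^sub>R (t powr (- a) * (1 + t\<^sup>2) powr (- \<sigma> / 2)))
        \<le> norm (indicator {0..1} t *\<^sub>R t powr (- a) + indicator {1..} t *\<^sub>R t powr (- a - \<sigma>))"
    proof (intro AE_I2)
      fix t :: real
      consider "t \<le> 0" | "0 < t" "t < 1" | "t \<ge> 1" by linarith
      then show "norm (indicator {0<..} t *\<^sub>R (t powr (- a) * (1 + t\<^sup>2) powr (- \<sigma> / 2)))
        \<le> norm (indicator {0..1} t *\<^sub>R t powr (- a) + indicator {1..} t *\<^sub>R t powr (- a - \<sigma>))"
      proof cases
        case 2
        have "(1 + t\<^sup>2) powr (- \<sigma> / 2) \<le> (1 + t\<^sup>2) powr 0"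
          using assms by (intro powr_mono) auto
        also have "\<dots> = 1" by (simp add: add_pos_nonneg less_imp_neq[symmetric])
        finally show ?thesis using 2 by (auto simp: abs_mult add_pos_nonneg intro!: mult_left_le)
      next
        case 3
        have "(1 + t\<^sup>2) powr (- \<sigma> / 2) \<le> (t\<^sup>2) powr (- \<sigma> / 2)"
          using assms 3 by (intro powr_mono2') auto
        also have "(t\<^sup>2) powr (- \<sigma> / 2) = t powr (- \<sigma>)"
          using 3 by (simp add: powr_powr flip: powr_numeral)
        finally have "t powr (- a) * (1 + t\<^sup>2) powr (- \<sigma> / 2) \<le> t powr (- a) * t powr (- \<sigma>)"
          by (intro mult_left_mono) auto
        then have "t powr (- a) * (1 + t\<^sup>2) powr (- \<sigma> / 2) \<le> t powr (- a - \<sigma>)"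
          by (simp add: powr_add[symmetric])
        then show ?thesis using 3 by (auto simp: abs_mult indicator_def)
      qed auto
    qed
  qed measurable
qed

lemma norm_one_plus_i_powi:
  "norm ((1 + \<i> * complex_of_real t) powi n) = (1 + t\<^sup>2) powr (real_of_int n / 2)"
proof -
  have pos: "1 + t\<^sup>2 > 0" by (simp add: add_pos_nonneg)
  have "norm (1 + \<i> * complex_of_real t) = (1 + t\<^sup>2) powr (1 / 2)"
    using pos by (simp add: cmod_def powr_half_sqrt)
  then have "norm ((1 + \<i> * complex_of_real t) powi n) = ((1 + t\<^sup>2) powr (1 / 2)) powi n"
    by (simp add: norm_power_int)
  also have "\<dots> = ((1 + t\<^sup>2) powr (1 / 2)) powr (of_int n)"
    using pos by (subst powr_real_of_int') auto
  finally show ?thesis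
    by (simp add: powr_powr)
qed

definition I_integrand :: "int \<Rightarrow> complex \<Rightarrow> complex \<Rightarrow> real \<Rightarrow> complex" where
  "I_integrand n \<zeta> \<xi> t =
     of_real (1 + t\<^sup>2) powr (- \<zeta> / 2) * of_real t powr (- \<xi>) * (1 + \<i> * of_real t) powi n"

lemma I_integrand_measurable [measurable]: "I_integrand n \<zeta> \<xi> \<in> borel_measurable borel"
proof -
  have "(\<lambda>t::real. (1 + \<i> * of_real t) powi n) \<in> borel_measurable borel"
    by (intro borel_measurable_continuous_onI continuous_on_power_int continuous_intros)
       (auto simp: complex_eq_iff)
  then show ?thesis
    unfolding I_integrand_def by measurable
qed

lemma norm_I_integrand:
  assumes "t > 0"
  shows "norm (I_integrand n \<zeta> \<xi> t) = t powr (- Re \<xi>) * (1 + t\<^sup>2) powr (- (Re \<zeta> - real_of_int n) / 2)"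
proof -
  have pos: "1 + t\<^sup>2 > 0" by (simp add: add_pos_nonneg)
  have "norm (of_real (1 + t\<^sup>2) powr (- \<zeta> / 2)) = (1 + t\<^sup>2) powr (- Re \<zeta> / 2)"
    using pos by (subst norm_powr_real_powr) auto
  then show ?thesis
    using assms pos unfolding I_integrand_def norm_mult norm_one_plus_i_powi
    by (simp add: norm_powr_real_powr field_simps flip: powr_add)
qed

lemma set_integrable_I_integrand:
  assumes "0 < Re \<xi>" "Re \<xi> < 1" "Re \<zeta> > real_of_int n + 1"
  shows "set_integrable lborel {0<..} (I_integrand n \<zeta> \<xi>)"
  unfolding set_integrable_def
proof (rule Bochner_Integration.integrable_bound)
  show "integrable lborel (\<lambda>t. indicator {0<..} t *\<^sub>R (t powr (- Re \<xi>) * (1 + t\<^sup>2) powr (- (Re \<zeta> - real_of_int n) / 2)))"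
    using set_integrable_powr_weight[of "Re \<xi>" "Re \<zeta> - real_of_int n"] assms
    by (simp add: set_integrable_def)
qed (auto simp: norm_I_integrand indicator_def)

lemma I_fun_eq: "I_fun n \<zeta> \<xi> = (LINT t:{0<..}|lborel. I_integrand n \<zeta> \<xi> t)"
  unfolding I_fun_def set_lebesgue_integral_def I_integrand_def
  by (rule integral_discrete_difference[where X = "{0}"]) (auto simp: indicator_def)

text \<open>This exhibits the kernel as a Laplace transform in \<open>\<zeta>\<close> with the
  nonnegative phase \<open>ln (1 + t\<^sup>2) / 2\<close>, which gives holomorphy. For
  \<open>\<eta> = 2 * N\<close> the exponential is the \<open>N\<close>-th power of
  \<open>1 / (1 + t\<^sup>2)\<close>, which gives moments.\<close>

lemma I_integrand_shift:
  "I_integrand n (\<zeta> + \<eta>) \<xi> t = I_integrand n \<zeta> \<xi> t * exp (- \<eta> * of_real (ln (1 + t\<^sup>2) / 2))"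
proof -
  have pos: "1 + t\<^sup>2 > 0" by (simp add: add_pos_nonneg)
  have "of_real (1 + t\<^sup>2) powr (- (\<zeta> + \<eta>) / 2) =
      of_real (1 + t\<^sup>2) powr (- \<zeta> / 2) * exp (- \<eta> * of_real (ln (1 + t\<^sup>2) / 2))"
    using pos Ln_of_real[of "1 + t\<^sup>2"] unfolding powr_def
    by (auto simp: exp_add[symmetric] ring_distribs diff_divide_distrib add_divide_distrib simp del: of_real_add)
  then show ?thesis
    unfolding I_integrand_def by (simp only: mult_ac)
qed

lemma holomorphic_I_fun:
  assumes "0 < Re \<xi>" "Re \<xi> < 1"
  shows "(\<lambda>\<zeta>. I_fun n \<zeta> \<xi>) holomorphic_on {\<zeta>. Re \<zeta> > real_of_int n + 1}"
proof -
  let ?k = "\<lambda>t. indicator {0<..} t *\<^sub>R I_integrand n 0 \<xi> t"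
  have eq: "?k t * exp (- \<zeta> * of_real (ln (1 + t\<^sup>2) / 2)) = indicator {0<..} t *\<^sub>R I_integrand n \<zeta> \<xi> t" for \<zeta> t
    using I_integrand_shift[of n 0 \<zeta> \<xi> t] by simp
  have "(\<lambda>\<zeta>. LINT t|lborel. ?k t * exp (- \<zeta> * of_real (ln (1 + t\<^sup>2) / 2))) holomorphic_on {\<zeta>. Re \<zeta> > real_of_int n + 1}"
  proof (rule holomorphic_laplace)
    show "integrable lborel (\<lambda>t. ?k t * exp (- \<zeta> * of_real (ln (1 + t\<^sup>2) / 2)))"
      if "Re \<zeta> > real_of_int n + 1" for \<zeta>
      unfolding eq using set_integrable_I_integrand[OF assms that] by (simp only: set_integrable_def)
  qed auto
  then show ?thesis
    unfolding eq by (simp add: I_fun_eq set_lebesgue_integral_def)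
qed

lemma I_fun_nonzero:
  assumes "0 < Re \<xi>" "Re \<xi> < 1"
  shows "\<exists>\<zeta>. Re \<zeta> > real_of_int n + 1 \<and> I_fun n \<zeta> \<xi> \<noteq> 0"
proof (rule ccontr)
  \<comment> \<open>The values at \<open>\<zeta> + 2 * N\<close> are the moments of the weight \<open>w\<close> in the variable \<open>p = 1 / (1 + t\<^sup>2)\<close>;
    if they all vanish, so does the integral of \<open>w\<close> against a bump \<open>\<psi> \<circ> p\<close> supported near \<open>t = 1\<close>.\<close>
  assume "\<not> ?thesis"
  then have zero: "I_fun n \<zeta> \<xi> = 0" if "Re \<zeta> > real_of_int n + 1" for \<zeta>
    using that by blast
  \<comment> \<open>A point with real part above \<open>n + 1\<close>; its shifts by
    \<open>2 * N\<close> all stay in the half plane where the kernel is assumed to vanish.\<close>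
  define \<zeta> where "\<zeta> = complex_of_real (real_of_int n + 2)"
  define v where "v = I_integrand n \<zeta> \<xi>"
  define w where "w t = indicator {0<..} t *\<^sub>R v t" for t
  define p where "p t = inverse (1 + t\<^sup>2)" for t :: real
  have pos: "1 + t\<^sup>2 > 0" for t :: real by (simp add: add_pos_nonneg)
  have [measurable]: "v \<in> borel_measurable borel" "p \<in> borel_measurable borel"
    unfolding v_def p_def by measurable
  have w_int: "integrable lborel w"
    using set_integrable_I_integrand[OF assms, of n \<zeta>] unfolding w_def v_def set_integrable_def
    by (simp add: \<zeta>_def)
  have p01: "p t \<in> {0..1}" for t
    using pos[of t] by (auto simp: p_def field_simps)
  have moments: "(LINT t|lborel. w t * of_real (p t ^ N)) = 0" for N
  proof -
    have "w t * of_real (p t ^ N) = indicator {0<..} t *\<^sub>R I_integrand n (\<zeta> + of_nat (2 * N)) \<xi> t" for t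
    proof -
      have "exp (- of_nat (2 * N) * complex_of_real (ln (1 + t\<^sup>2) / 2)) = of_real (exp (- real N * ln (1 + t\<^sup>2)))"
        by (simp flip: exp_of_real)
      also have "exp (- real N * ln (1 + t\<^sup>2)) = p t ^ N"
        using pos[of t] by (simp add: p_def exp_minus exp_of_nat_mult power_inverse)
      finally show ?thesis
        unfolding I_integrand_shift w_def v_def by simp
    qed
    then have "(LINT t|lborel. w t * of_real (p t ^ N)) = I_fun n (\<zeta> + of_nat (2 * N)) \<xi>"
      by (simp add: I_fun_eq set_lebesgue_integral_def)
    also have "\<dots> = 0"
      by (rule zero) (simp add: \<zeta>_def)
    finally show ?thesis .
  qed
  have v1: "v 1 \<noteq> 0"
    using norm_I_integrand[of 1 n \<zeta> \<xi>] by (auto simp: v_def)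
  have "isCont v 1"
    unfolding v_def I_integrand_def
    by (intro continuous_intros) (auto simp: complex_eq_iff complex_nonpos_Reals_iff)
  \<comment> \<open>Multiplication by \<open>cnj (v 1)\<close> rotates the complex weight so that
    its real part is positive at 1, hence near 1.\<close>
  then have "isCont (\<lambda>t. Re (cnj (v 1) * v t)) 1"
    unfolding isCont_def by (intro tendsto_intros)
  moreover have "Re (cnj (v 1) * v 1) > 0"
    using v1 by (simp add: complex_norm_square[symmetric] mult.commute[of "cnj _"] flip: of_real_power)
  ultimately have "\<forall>\<^sub>F t in at 1. Re (cnj (v 1) * v t) > 0"
    unfolding isCont_def by (rule order_tendstoD(1))
  then obtain d where d: "d > 0" "\<And>t. dist t 1 < d \<Longrightarrow> Re (cnj (v 1) * v t) > 0"
    unfolding eventually_at using \<open>Re (cnj (v 1) * v 1) > 0\<close> by (metis UNIV_I)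
  \<comment> \<open>The cap 1/2 keeps \<open>1 - \<delta>\<close> positive, so that the monotonicity
    of \<open>p\<close> on positive arguments applies.\<close>
  define \<delta> where "\<delta> = min d (1/2)"
  have \<delta>: "0 < \<delta>" "\<delta> < 1" "\<delta> \<le> d"
    using d(1) by (auto simp: \<delta>_def)
  \<comment> \<open>The function \<open>p\<close> decreases, so the two factors are both positive
    exactly between the images of \<open>1 + \<delta>\<close> and \<open>1 - \<delta>\<close>;
    cutting off at 0 gives a continuous bump.\<close>
  define \<psi> where "\<psi> x = max 0 ((x - p (1 + \<delta>)) * (p (1 - \<delta>) - x))" for x
  have p_less: "p s < p t \<longleftrightarrow> t < s" if "s > 0" "t > 0" for s t
  proof -
    have "p s < p t \<longleftrightarrow> t\<^sup>2 < s\<^sup>2"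
      using pos[of s] pos[of t] by (simp add: p_def inverse_less_iff_less)
    also have "\<dots> \<longleftrightarrow> t < s"
      using that power2_less_imp_less[of t s] power_strict_mono[of t s 2] by auto
    finally show ?thesis .
  qed
  have \<psi>_pos: "\<psi> (p t) > 0 \<longleftrightarrow> 1 - \<delta> < t \<and> t < 1 + \<delta>" if "t > 0" for t
  proof -
    \<comment> \<open>Two negative factors would force
      \<open>p (1 - \<delta>) < p (1 + \<delta>)\<close>, which contradicts the monotonicity of
      \<open>p\<close>.\<close>
    have "\<psi> (p t) > 0 \<longleftrightarrow> (p t > p (1 + \<delta>) \<and> p (1 - \<delta>) > p t) \<or> (p t < p (1 + \<delta>) \<and> p (1 - \<delta>) < p t)"
      unfolding \<psi>_def by (auto simp: zero_less_mult_iff less_max_iff_disj)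
    also have "\<dots> \<longleftrightarrow> 1 - \<delta> < t \<and> t < 1 + \<delta>"
      using that \<delta> by (simp add: p_less) linarith
    finally show ?thesis .
  qed
  have \<psi>_nonneg: "\<psi> x \<ge> 0" for x by (simp add: \<psi>_def)
  have \<psi>_cont: "continuous_on A \<psi>" for A
    unfolding \<psi>_def by (intro continuous_intros)
  then have [measurable]: "\<psi> \<in> borel_measurable borel"
    by (rule borel_measurable_continuous_onI)
  have zero_int: "(LINT t|lborel. w t * of_real (\<psi> (p t))) = 0"
    by (rule integral_mult_continuous_eq_0[OF w_int]) (use p01 moments \<psi>_cont in auto)
  let ?u = "\<lambda>t. Re (cnj (v 1) * (w t * of_real (\<psi> (p t))))"
  have u_eq: "?u t = (if t > 0 then Re (cnj (v 1) * v t) * \<psi> (p t) else 0)" for t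
    by (simp add: w_def algebra_simps)
  have int: "integrable lborel (\<lambda>t. w t * of_real (\<psi> (p t)))"
  proof (rule Bochner_Integration.integrable_bound)
    show "integrable lborel (\<lambda>t. norm (w t) * 1)"
      using integrable_norm[OF w_int] by simp
    have "\<psi> (p t) \<le> 1" for t
    proof -
      have "(p t - p (1 + \<delta>)) * (p (1 - \<delta>) - p t) \<le> \<bar>p t - p (1 + \<delta>)\<bar> * \<bar>p (1 - \<delta>) - p t\<bar>"
        by (simp flip: abs_mult)
      also have "\<dots> \<le> 1 * 1"
        using p01[of t] p01[of "1 + \<delta>"] p01[of "1 - \<delta>"] by (intro mult_mono) auto
      finally show ?thesis by (simp add: \<psi>_def)
    qed
    then have "norm (w t) * \<psi> (p t) \<le> norm (w t) * 1" for t
      by (intro mult_left_mono) auto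
    then show "AE t in lborel. norm (w t * of_real (\<psi> (p t))) \<le> norm (norm (w t) * 1)"
      using \<psi>_nonneg by (intro AE_I2) (simp add: norm_mult)
  qed (use w_int in measurable)
  have "(LINT t|lborel. ?u t) = Re (cnj (v 1) * (LINT t|lborel. w t * of_real (\<psi> (p t))))"
    using int by (subst integral_mult_right_zero[symmetric], subst integral_Re) auto
  then have "(LINT t|lborel. ?u t) = 0"
    by (simp only: zero_int mult_zero_right zero_complex.sel)
  moreover have u_nonneg: "?u t \<ge> 0" for t
  proof (cases "t > 0 \<and> \<psi> (p t) > 0")
    case True
    then have "dist t 1 < d"
      using \<psi>_pos[of t] \<delta> by (auto simp: dist_real_def)
    from d(2)[OF this] True show ?thesis unfolding u_eq by simp
  next
    case False
    then show ?thesis unfolding u_eq using \<psi>_nonneg[of "p t"] by auto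
  qed
  moreover have "integrable lborel ?u"
    using int by (intro integrable_Re integrable_mult_right)
  ultimately have "AE t in lborel. ?u t = 0"
    by (subst (asm) integral_nonneg_eq_0_iff_AE) auto
  \<comment> \<open>A nonnegative function with integral 0 vanishes almost everywhere, yet
    \<open>?u\<close> is positive on a whole interval around 1.\<close>
  then have "AE t in lborel. t \<notin> {1 - \<delta><..<1 + \<delta>}"
  proof eventually_elim
    case (elim t)
    show ?case
    proof
      assume t: "t \<in> {1 - \<delta><..<1 + \<delta>}"
      then have "t > 0" "dist t 1 < d" using \<delta> by (auto simp: dist_real_def)
      with d(2)[of t] \<psi>_pos[of t] t have "?u t > 0" unfolding u_eq by simp
      with elim show False by simp
    qed
  qed
  then have "emeasure lborel {1 - \<delta><..<1 + \<delta>} = 0"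
    by (subst (asm) AE_iff_null_sets[symmetric]) auto
  then show False using \<delta>(1) by simp
qed

text \<open>Zeros of a nonconstant holomorphic function on a connected open set are isolated, and
  writing the half plane as a countable union of closed sets makes them countable. In the constant
  case the known nonzero value excludes zeros altogether.\<close>

lemma countable_I_fun_zeros:
  assumes "0 < Re \<xi>" "Re \<xi> < 1"
  shows "countable {\<zeta>. Re \<zeta> > real_of_int n + 1 \<and> I_fun n \<zeta> \<xi> = 0}"
proof (cases "(\<lambda>\<zeta>. I_fun n \<zeta> \<xi>) constant_on {\<zeta>. Re \<zeta> > real_of_int n + 1}")
  case True
  then have "{\<zeta>. Re \<zeta> > real_of_int n + 1 \<and> I_fun n \<zeta> \<xi> = 0} = {}"
    using I_fun_nonzero[OF assms, of n] unfolding constant_on_def by fastforce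
  then show ?thesis by (simp only: countable_empty)
next
  case False
  let ?S = "{\<zeta>. Re \<zeta> > real_of_int n + 1}"
  have "?S = (\<Union>k::nat. {\<zeta>. Re \<zeta> \<ge> real_of_int n + 1 + inverse (real (Suc k))})"
  proof safe
    fix \<zeta> :: complex assume "Re \<zeta> > real_of_int n + 1"
    then have "Re \<zeta> - (real_of_int n + 1) > 0" by simp
    from reals_Archimedean[OF this] obtain k where "inverse (real (Suc k)) < Re \<zeta> - (real_of_int n + 1)" ..
    then show "\<zeta> \<in> (\<Union>k::nat. {\<zeta>. Re \<zeta> \<ge> real_of_int n + 1 + inverse (real (Suc k))})"
      by (intro UN_I[of k]) auto
  next
    fix \<zeta> :: complex and k :: nat assume "Re \<zeta> \<ge> real_of_int n + 1 + inverse (real (Suc k))"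
    moreover have "inverse (real (Suc k)) > 0" by simp
    ultimately show "Re \<zeta> > real_of_int n + 1" by linarith
  qed
  then have fsigma: "fsigma ?S"
    by (simp only: fsigma.intros[OF closed_halfspace_Re_ge])
  have "countable {\<zeta> \<in> {\<zeta>. Re \<zeta> > real_of_int n + 1}. I_fun n \<zeta> \<xi> = 0}"
    by (rule holomorphic_countable_zeros[OF holomorphic_I_fun[OF assms] _ _ fsigma False])
       (auto intro: open_halfspace_Re_gt convex_connected convex_halfspace_Re_gt)
  then show ?thesis by simp
qed

section \<open>Fourier coefficients of line integrals\<close>

text \<open>The piece of the shifted interval to the right of \<open>pi\<close> is moved back by one
  period. The range of \<open>\<alpha>\<close> is chosen to contain the values of
  \<open>Arg2pi\<close>.\<close>

lemma integral_periodic_shift: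
  fixes q :: "real \<Rightarrow> complex"
  assumes cont: "continuous_on UNIV q" and per: "\<And>x. q (x + 2 * pi) = q x"
    and \<alpha>: "0 \<le> \<alpha>" "\<alpha> \<le> 2 * pi"
  shows "integral {-pi..pi} (\<lambda>x. q (x + \<alpha>)) = integral {-pi..pi} q"
proof -
  have c: "continuous_on A q" for A using cont continuous_on_subset by blast
  have int: "q integrable_on {x..y}" for x y
    using c by (rule integrable_continuous_real)
  have "integral {-pi..pi} (\<lambda>x. q (x + \<alpha>)) = integral {-pi + \<alpha>..pi + \<alpha>} q"
    using integral_shift[OF c, of "-pi" pi \<alpha>] by (simp add: o_def)
  also have "\<dots> = integral {-pi + \<alpha>..pi} q + integral {pi..pi + \<alpha>} q"
    using \<alpha> int by (intro Henstock_Kurzweil_Integration.integral_combine[symmetric]) auto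
  also have "integral {pi..pi + \<alpha>} q = integral {-pi..-pi + \<alpha>} q"
    using integral_shift[OF c, of "-pi" "-pi + \<alpha>" "2 * pi"] by (simp add: o_def per add_ac)
  also have "integral {-pi + \<alpha>..pi} q + integral {-pi..-pi + \<alpha>} q = integral {-pi..pi} q"
    using \<alpha> int by (subst add.commute, intro Henstock_Kurzweil_Integration.integral_combine) auto
  finally show ?thesis .
qed

lemma fourier_coeff_integral:
  assumes "continuous_on UNIV g"
  shows "fourier_coeff n g = 1 / (2 * of_real pi) * integral {-pi..pi} (\<lambda>\<phi>. g \<phi> * exp (- \<i> * of_int n * of_real \<phi>))"
  unfolding fourier_coeff_def
  by (subst set_borel_integral_eq_integral(2))
     (auto intro!: borel_integrable_atLeastAtMost' continuous_intros continuous_on_subset[OF assms])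

text \<open>The horizontal plane is identified with the complex numbers, so that rotation about the
  axis is multiplication by \<open>cis \<phi>\<close>. The bound \<open>a > 0\<close> quantifies
  compact support in the open half space: it keeps \<open>\<tau>\<close> away from the singularity
  of \<open>\<tau> powr (\<xi> - 1)\<close> and removes the half \<open>u \<le> 0\<close> of the
  lines.\<close>

locale half_space_function =
  fixes p :: "complex \<Rightarrow> real \<Rightarrow> complex" and R a b C :: real and n :: int
  assumes p_cont: "continuous_on UNIV (\<lambda>(z, \<tau>). p z \<tau>)"
    and p_supp: "\<And>z \<tau>. p z \<tau> \<noteq> 0 \<Longrightarrow> norm z \<le> R \<and> a \<le> \<tau> \<and> \<tau> \<le> b"
    and a_pos: "a > 0" and p_bound: "\<And>z \<tau>. norm (p z \<tau>) \<le> C"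
begin

lemma p_cont' [continuous_intros]:
  "continuous_on A u \<Longrightarrow> continuous_on A v \<Longrightarrow> continuous_on A (\<lambda>x. p (u x) (v x))"
  using continuous_on_compose2[OF p_cont, of A "\<lambda>x. (u x, v x)"]
  by (auto intro: continuous_on_Pair)

definition fc :: "real \<Rightarrow> real \<Rightarrow> complex" where
  "fc r \<tau> = fourier_coeff n (\<lambda>\<phi>. p (of_real r * cis \<phi>) \<tau>)"

lemma fc_eq: "fc r \<tau> = 1 / (2 * of_real pi) *
   integral {-pi..pi} (\<lambda>\<phi>. p (of_real r * cis \<phi>) \<tau> * exp (- \<i> * of_int n * of_real \<phi>))"
  unfolding fc_def by (intro fourier_coeff_integral continuous_intros)

lemma fc_cont: "continuous_on UNIV (\<lambda>(r, \<tau>). fc r \<tau>)"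
proof -
  have "continuous_on (UNIV \<times> cbox (-pi) pi)
    (\<lambda>((r, \<tau>), \<phi>). p (complex_of_real r * cis \<phi>) \<tau> * exp (- \<i> * of_int n * of_real \<phi>))"
    unfolding case_prod_beta by (intro continuous_intros)
  then have "continuous_on UNIV
      (\<lambda>z :: real \<times> real. integral (cbox (-pi) pi) (\<lambda>\<phi>. p (of_real (fst z) * cis \<phi>) (snd z) * exp (- \<i> * of_int n * of_real \<phi>)))"
    by (intro integral_continuous_on_param) (simp add: case_prod_beta)
  then show ?thesis
    unfolding fc_eq case_prod_beta by (intro continuous_intros) simp
qed

lemma fc_cont' [continuous_intros]:
  "continuous_on A u \<Longrightarrow> continuous_on A v \<Longrightarrow> continuous_on A (\<lambda>x. fc (u x) (v x))"
  using continuous_on_compose2[OF fc_cont, of A "\<lambda>x. (u x, v x)"]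
  by (auto intro: continuous_on_Pair)

lemma fc_measurable [measurable]: "(\<lambda>(r, \<tau>). fc r \<tau>) \<in> borel_measurable (borel \<Otimes>\<^sub>M borel)"
  using borel_measurable_continuous_onI[OF fc_cont] by (simp add: borel_prod)

lemma fc_bound: "norm (fc r \<tau>) \<le> C"
proof -
  have "norm (integral {-pi..pi} (\<lambda>\<phi>. p (of_real r * cis \<phi>) \<tau> * exp (- \<i> * of_int n * of_real \<phi>)))
      \<le> C * (pi - (-pi))"
    by (rule integral_bound) (auto intro!: continuous_intros simp: norm_mult p_bound)
  then show ?thesis
    unfolding fc_eq by (simp add: norm_mult norm_divide field_simps)
qed

lemma fc_supp:
  assumes "fc r \<tau> \<noteq> 0"
  shows "\<bar>r\<bar> \<le> R \<and> a \<le> \<tau> \<and> \<tau> \<le> b"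
proof (rule ccontr)
  assume "\<not> ?thesis"
  then have "p (of_real r * cis \<phi>) \<tau> = 0" for \<phi>
    using p_supp[of "of_real r * cis \<phi>" \<tau>] by (auto simp: norm_mult)
  then have "fc r \<tau> = 0" by (simp add: fc_eq)
  with assms show False by simp
qed

text \<open>With \<open>z = norm z * cis \<alpha>\<close> the rotation shifts the angle by
  \<open>\<alpha>\<close>, which multiplies the \<open>n\<close>-th coefficient by
  \<open>cis \<alpha> powi n\<close>. This is the origin of \<open>(1 + \<i> * t) powi n\<close> in
  the kernel.\<close>

lemma fourier_coeff_rotate:
  assumes "z \<noteq> 0"
  shows "fourier_coeff n (\<lambda>\<phi>. p (cis \<phi> * z) \<tau>) = sgn z powi n * fc (norm z) \<tau>"
proof -
  define \<alpha> where "\<alpha> = Arg2pi z"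
  have \<alpha>: "0 \<le> \<alpha>" "\<alpha> \<le> 2 * pi"
    using Arg2pi_lt_2pi[of z] by (auto simp: \<alpha>_def Arg2pi_ge_0)
  have z: "z = of_real (norm z) * cis \<alpha>"
    using Arg2pi_eq[of z] by (simp add: \<alpha>_def cis_conv_exp)
  then have sgn: "sgn z = cis \<alpha>"
    using assms by (metis nonzero_mult_div_cancel_left norm_eq_zero of_real_eq_0_iff sgn_eq)
  define q where "q \<phi> = p (of_real (norm z) * cis \<phi>) \<tau> * exp (- \<i> * of_int n * of_real \<phi>)" for \<phi>
  have per: "q (x + 2 * pi) = q x" for x
  proof -
    have "exp (- \<i> * of_int n * of_real (x + 2 * pi)) = exp (- \<i> * of_int n * of_real x) * exp (2 * of_int (- n) * of_real pi * \<i>)"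
      by (simp add: exp_add[symmetric] algebra_simps)
    also have "exp (2 * of_int (- n) * of_real pi * \<i>) = 1"
      using exp_integer_2pi[of "of_int (- n)"] by simp
    finally show ?thesis by (simp add: q_def cis_mult[symmetric])
  qed
  have "p (cis \<phi> * z) \<tau> * exp (- \<i> * of_int n * of_real \<phi>) = cis \<alpha> powi n * q (\<phi> + \<alpha>)" for \<phi>
  proof -
    have "cis \<alpha> powi n = exp (\<i> * of_int n * of_real \<alpha>)"
      by (subst cis_power_int) (simp add: cis_conv_exp mult_ac)
    moreover have "cis \<phi> * z = of_real (norm z) * cis (\<phi> + \<alpha>)"
      by (subst z) (simp add: cis_mult[symmetric])
    ultimately show ?thesis
      by (simp add: q_def exp_add[symmetric] algebra_simps flip: exp_minus)
  qed
  then have "fourier_coeff n (\<lambda>\<phi>. p (cis \<phi> * z) \<tau>) =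
     1 / (2 * of_real pi) * integral {-pi..pi} (\<lambda>\<phi>. cis \<alpha> powi n * q (\<phi> + \<alpha>))"
    by (subst fourier_coeff_integral) (auto intro!: continuous_intros)
  also have "integral {-pi..pi} (\<lambda>\<phi>. cis \<alpha> powi n * q (\<phi> + \<alpha>)) = cis \<alpha> powi n * integral {-pi..pi} q"
  proof -
    have "integral {-pi..pi} (\<lambda>x. q (x + \<alpha>)) = integral {-pi..pi} q"
      using per \<alpha> by (intro integral_periodic_shift) (auto simp: q_def intro!: continuous_intros)
    then show ?thesis by simp
  qed
  finally show ?thesis
    by (simp add: fc_eq q_def[abs_def] sgn)
qed

lemma p_large: "R < norm z \<Longrightarrow> p z \<tau> = 0"
  using p_supp[of z \<tau>] by force

text \<open>The lines are unbounded, but \<open>p\<close> vanishes for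
  \<open>\<bar>u\<bar> > R\<close>; the indicator of \<open>{-R..R}\<close> serves as the integrable
  factor in the Fubini lemma for bounded kernels.\<close>

lemma fourier_coeff_line:
  "fourier_coeff n (\<lambda>\<phi>. LINT u|lborel. p (cis \<phi> * Complex l u) (s * u)) =
   (LINT u|lborel. fourier_coeff n (\<lambda>\<phi>. p (cis \<phi> * Complex l u) (s * u)))"
proof -
  define k where "k \<phi> u = p (cis \<phi> * Complex l u) (s * u) * exp (- \<i> * of_int n * of_real \<phi>)" for \<phi> u
  let ?g = "\<lambda>u. complex_of_real (indicator {-R..R} u)"
  have g_int: "integrable lborel ?g"
    by (intro integrable_of_real integrable_real_indicator) (auto simp: emeasure_lborel_Icc_eq)
  have k_meas: "case_prod k \<in> borel_measurable (borel \<Otimes>\<^sub>M borel)"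
    unfolding borel_prod k_def case_prod_beta Complex_eq
    by (intro borel_measurable_continuous_onI continuous_intros)
  have k_bd: "norm (k \<phi> u) \<le> C" for \<phi> u
    by (simp add: k_def norm_mult p_bound)
  have gk: "?g u * k \<phi> u = k \<phi> u" for \<phi> u
  proof (cases "u \<in> {-R..R}")
    case False
    then have "R < norm (cis \<phi> * Complex l u)"
      using abs_Im_le_cmod[of "Complex l u"] by (auto simp: norm_mult)
    then show ?thesis by (simp add: k_def p_large)
  qed simp
  have "fourier_coeff n (\<lambda>\<phi>. LINT u|lborel. p (cis \<phi> * Complex l u) (s * u)) =
      1 / (2 * of_real pi) * (LINT \<phi>:{-pi..pi}|lborel. LINT u|lborel. ?g u * k \<phi> u)"
    unfolding fourier_coeff_def gk by (simp add: k_def)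
  also have "(LINT \<phi>:{-pi..pi}|lborel. LINT u|lborel. ?g u * k \<phi> u) =
      (LINT u|lborel. ?g u * (LINT \<phi>:{-pi..pi}|lborel. k \<phi> u))"
    by (rule Fubini_bounded_kernel[OF g_int k_meas k_bd])
  also have "1 / (2 * of_real pi) * \<dots> = (LINT u|lborel. 1 / (2 * of_real pi) * (LINT \<phi>:{-pi..pi}|lborel. ?g u * k \<phi> u))"
    by (simp only: integral_mult_right_zero set_integral_mult_right)
  also have "\<dots> = (LINT u|lborel. fourier_coeff n (\<lambda>\<phi>. p (cis \<phi> * Complex l u) (s * u)))"
    unfolding gk by (simp add: k_def fourier_coeff_def)
  finally show ?thesis .
qed

text \<open>For \<open>u \<le> 0\<close> the height \<open>s * u\<close> lies below
  \<open>a\<close>, and for \<open>u > R\<close> the horizontal distance exceeds \<open>R\<close>.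
  The cut-off at \<open>R\<close> is kept in the weight because the superposition lemma needs an
  integrable weight.\<close>

lemma fourier_coeff_line_pos:
  assumes "l > 0" "s > 0"
  shows "fourier_coeff n (\<lambda>\<phi>. LINT u|lborel. p (cis \<phi> * Complex l u) (s * u)) =
    (LINT u:{0<..}|lborel. (indicator {..R} u * sgn (Complex l u) powi n) * fc (norm (Complex l u)) (s * u))"
  unfolding fourier_coeff_line set_lebesgue_integral_def
proof (intro Bochner_Integration.integral_cong refl)
  fix u :: real
  have "Complex l u \<noteq> 0" using \<open>l > 0\<close> by (simp add: complex_eq_iff)
  moreover have "fc (norm (Complex l u)) (s * u) = 0" if "u \<le> 0 \<or> u > R"
  proof (rule ccontr)
    assume "fc (norm (Complex l u)) (s * u) \<noteq> 0"
    from fc_supp[OF this] have "norm (Complex l u) \<le> R" "s * u > 0" using a_pos by auto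
    moreover have "\<bar>u\<bar> \<le> norm (Complex l u)" using abs_Im_le_cmod[of "Complex l u"] by simp
    ultimately show False using that \<open>s > 0\<close> by (auto simp: zero_less_mult_iff)
  qed
  ultimately show "fourier_coeff n (\<lambda>\<phi>. p (cis \<phi> * Complex l u) (s * u)) =
      indicator {0<..} u *\<^sub>R ((indicator {..R} u * sgn (Complex l u) powi n) * fc (norm (Complex l u)) (s * u))"
    by (auto simp: fourier_coeff_rotate indicator_def)
qed

definition Fm :: "complex \<Rightarrow> real \<Rightarrow> complex" where
  "Fm \<xi> r = mellin (fc r) \<xi>"

text \<open>The support in \<open>{a..b}\<close> with \<open>a > 0\<close> avoids the singularity at
  0, so the transform is a compact parameter integral for every \<open>\<xi>\<close>; its continuity
  in \<open>r\<close> follows.\<close>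

lemma Fm_eq: "Fm \<xi> r = integral {a..b} (\<lambda>\<tau>. of_real \<tau> powr (\<xi> - 1) * fc r \<tau>)"
proof -
  have "Fm \<xi> r = (LINT \<tau>:{a..b}|lborel. of_real \<tau> powr (\<xi> - 1) * fc r \<tau>)"
    unfolding Fm_def mellin_eq_integral_pos set_lebesgue_integral_def
  proof (intro Bochner_Integration.integral_cong refl)
    fix \<tau> :: real
    show "indicator {0<..} \<tau> *\<^sub>R (of_real \<tau> powr (\<xi> - 1) * fc r \<tau>) = indicator {a..b} \<tau> *\<^sub>R (of_real \<tau> powr (\<xi> - 1) * fc r \<tau>)"
      using fc_supp[of r \<tau>] a_pos by (cases "fc r \<tau> = 0") (auto simp: indicator_def)
  qed
  also have "\<dots> = integral {a..b} (\<lambda>\<tau>. of_real \<tau> powr (\<xi> - 1) * fc r \<tau>)"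
    using a_pos by (intro set_borel_integral_eq_integral(2) borel_integrable_atLeastAtMost' continuous_intros)
      (auto simp: complex_nonpos_Reals_iff)
  finally show ?thesis .
qed

lemma Fm_cont: "continuous_on UNIV (Fm \<xi>)"
proof -
  have "continuous_on (UNIV \<times> cbox a b) (\<lambda>(r, \<tau>). complex_of_real \<tau> powr (\<xi> - 1) * fc r \<tau>)"
    unfolding case_prod_beta using a_pos
    by (intro continuous_intros) (auto simp: complex_nonpos_Reals_iff)
  then have "continuous_on UNIV (\<lambda>r. integral (cbox a b) (\<lambda>\<tau>. complex_of_real \<tau> powr (\<xi> - 1) * fc r \<tau>))"
    by (rule integral_continuous_on_param)
  then show ?thesis
    unfolding Fm_eq[abs_def] by simp
qed

lemma Fm_measurable [measurable]: "Fm \<xi> \<in> borel_measurable borel"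
  using Fm_cont by (rule borel_measurable_continuous_onI)

lemma Fm_supp: "Fm \<xi> r \<noteq> 0 \<Longrightarrow> \<bar>r\<bar> \<le> R"
  using fc_supp[of r] by (force simp: Fm_eq)

lemma Fm_bounded: "\<exists>B. \<forall>r. norm (Fm \<xi> r) \<le> B"
proof -
  have "compact (Fm \<xi> ` {-R..R})"
    using Fm_cont by (intro compact_continuous_image) (auto intro: continuous_on_subset)
  from compact_imp_bounded[OF this] obtain B where B: "B > 0" "\<And>r. r \<in> {-R..R} \<Longrightarrow> norm (Fm \<xi> r) \<le> B"
    unfolding bounded_pos by blast
  have "norm (Fm \<xi> r) \<le> B" for r
    using B(1) B(2)[of r] Fm_supp[of \<xi> r] by (cases "Fm \<xi> r = 0") (auto simp: abs_le_iff)
  then show ?thesis by blast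
qed

lemma sgn_Complex_measurable [measurable]:
  assumes "l > 0"
  shows "(\<lambda>u. sgn (Complex l u) powi n) \<in> borel_measurable borel"
proof (rule borel_measurable_continuous_onI)
  have "Complex l u \<noteq> 0" for u using assms by (simp add: complex_eq_iff)
  then show "continuous_on UNIV (\<lambda>u. sgn (Complex l u) powi n)"
    unfolding sgn_eq Complex_eq by (intro continuous_intros) (auto simp: sgn_eq Complex_eq)
qed

text \<open>Equality can fail only at \<open>z = 0\<close>, where \<open>sgn 0 = 0\<close> and the
  power is 0 or 1 according to \<open>k\<close>.\<close>

lemma norm_sgn_powi: "norm (sgn z powi k :: complex) \<le> 1"
proof (cases "z = 0")
  case False
  then show ?thesis by (simp add: norm_power_int norm_sgn)
qed (simp add: norm_power_int power_int_0_left_if)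

text \<open>An instance of \<open>mellin_superposition\<close> in which the dilation factor is
  \<open>u\<close> itself. The weight \<open>u powr (- Re \<xi>)\<close> is integrable near 0
  because \<open>Re \<xi> < 1\<close>, and for large \<open>u\<close> because of the
  cut-off.\<close>

lemma mellin_line:
  assumes "l > 0" and \<xi>: "Re \<xi> < 1"
  shows "mellin (\<lambda>s. LINT u:{0<..}|lborel. (indicator {..R} u * sgn (Complex l u) powi n) * fc (norm (Complex l u)) (s * u)) \<xi> =
    (LINT u:{0<..}|lborel. sgn (Complex l u) powi n * of_real u powr (- \<xi>) * Fm \<xi> (norm (Complex l u)))"
proof -
  have [measurable]: "(\<lambda>u. sgn (Complex l u) powi n) \<in> borel_measurable borel"
    by (rule sgn_Complex_measurable) fact
  have "(\<lambda>z. (\<lambda>(r, \<tau>). fc r \<tau>) ((\<lambda>(u, \<tau>). (norm (Complex l u), \<tau>)) z)) \<in> borel_measurable (borel \<Otimes>\<^sub>M borel)"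
  proof (rule measurable_compose[OF _ fc_measurable])
    have [measurable]: "(\<lambda>u. norm (Complex l u)) \<in> borel_measurable borel"
      by (intro borel_measurable_continuous_onI) (auto simp: Complex_eq intro!: continuous_intros)
    show "(\<lambda>(u, \<tau>). (norm (Complex l u), \<tau>)) \<in> borel \<Otimes>\<^sub>M borel \<rightarrow>\<^sub>M borel \<Otimes>\<^sub>M borel"
      by measurable
  qed
  then have fc_m: "case_prod (\<lambda>u. fc (norm (Complex l u))) \<in> borel_measurable (borel \<Otimes>\<^sub>M borel)"
    by (simp add: case_prod_beta)
  have "set_integrable lborel {0..max 0 R} (\<lambda>u. u powr (- Re \<xi>))"
    using \<xi> by (intro set_integrable_lborel_nonneg integrable_on_powr_from_0) auto
  then have w_int: "set_integrable lborel {0<..} (\<lambda>u. norm (indicator {..R} u * sgn (Complex l u) powi n) * u powr (- Re \<xi>))"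
    unfolding set_integrable_def
  proof (rule Bochner_Integration.integrable_bound)
    have "norm (sgn (Complex l u) powi n) * u powr (- Re \<xi>) \<le> 1 * u powr (- Re \<xi>)" for u
      by (intro mult_right_mono norm_sgn_powi) auto
    then show "AE u in lborel. norm (indicator {0<..} u *\<^sub>R (norm (indicator {..R} u * sgn (Complex l u) powi n) * u powr (- Re \<xi>)))
        \<le> norm (indicator {0..max 0 R} u *\<^sub>R u powr (- Re \<xi>))"
      by (intro AE_I2) (auto simp: indicator_def norm_mult)
  qed measurable
  have "set_integrable lborel {a..b} (\<lambda>\<tau>. \<tau> powr (Re \<xi> - 1) * C)"
    using a_pos by (intro borel_integrable_atLeastAtMost' continuous_intros) auto
  then have M_int: "set_integrable lborel {0<..} (\<lambda>\<tau>. \<tau> powr (Re \<xi> - 1) * (indicator {a..b} \<tau> * C))"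
    unfolding set_integrable_def
    by (rule Bochner_Integration.integrable_bound) (use a_pos in \<open>auto simp: indicator_def\<close>)
  have dom: "norm (fc (norm (Complex l u)) \<tau>) \<le> indicator {a..b} \<tau> * C" for u \<tau>
    using fc_supp[of "norm (Complex l u)" \<tau>] fc_bound[of "norm (Complex l u)" \<tau>]
    by (cases "fc (norm (Complex l u)) \<tau> = 0") (auto simp: indicator_def)
  have "mellin (\<lambda>s. LINT u:{0<..}|lborel. (indicator {..R} u * sgn (Complex l u) powi n) * fc (norm (Complex l u)) (s * u)) \<xi> =
     (LINT u:{0<..}|lborel. (indicator {..R} u * sgn (Complex l u) powi n) * of_real u powr (- \<xi>) * mellin (fc (norm (Complex l u))) \<xi>)"
    by (rule mellin_superposition[where M = "\<lambda>\<tau>. indicator {a..b} \<tau> * C" and F = "\<lambda>u. fc (norm (Complex l u))"])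
       (use fc_m w_int M_int dom in auto)
  \<comment> \<open>The cut-off can now be dropped, since \<open>Fm \<xi>\<close> vanishes beyond
    \<open>R\<close>.\<close>
  also have "\<dots> = (LINT u:{0<..}|lborel. sgn (Complex l u) powi n * of_real u powr (- \<xi>) * Fm \<xi> (norm (Complex l u)))"
  proof (rule set_lebesgue_integral_cong)
    show "\<forall>u. u \<in> {0<..} \<longrightarrow> (indicator {..R} u * sgn (Complex l u) powi n) * of_real u powr (- \<xi>) * mellin (fc (norm (Complex l u))) \<xi> =
        sgn (Complex l u) powi n * of_real u powr (- \<xi>) * Fm \<xi> (norm (Complex l u))"
    proof (intro allI impI)
      fix u :: real assume "u \<in> {0<..}"
      have "u \<le> norm (Complex l u)" using abs_Im_le_cmod[of "Complex l u"] by simp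
      then have "u > R \<Longrightarrow> Fm \<xi> (norm (Complex l u)) = 0"
        using Fm_supp[of \<xi> "norm (Complex l u)"] by fastforce
      then show "(indicator {..R} u * sgn (Complex l u) powi n) * of_real u powr (- \<xi>) * mellin (fc (norm (Complex l u))) \<xi> =
        sgn (Complex l u) powi n * of_real u powr (- \<xi>) * Fm \<xi> (norm (Complex l u))"
        by (cases "u \<le> R") (auto simp: Fm_def indicator_def)
    qed
  qed auto
  finally show ?thesis .
qed

end

section \<open>The radial Mellin transform of the line integrals\<close>

lemma mellin_powr_shift:
  "mellin (\<lambda>x. of_real x powr \<alpha> * F x) s = mellin F (s + \<alpha>)"
  unfolding mellin_eq_integral_pos
proof (rule set_lebesgue_integral_cong)
  show "\<forall>x. x \<in> {0<..} \<longrightarrow> of_real x powr (s - 1) * (of_real x powr \<alpha> * F x) = of_real x powr (s + \<alpha> - 1) * F x"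
  proof (intro allI impI)
    fix x :: real
    have "complex_of_real x powr (s - 1) * of_real x powr \<alpha> = of_real x powr (s + \<alpha> - 1)"
      unfolding powr_add[symmetric] by (rule arg_cong2[where f = "(powr)"]) simp_all
    then show "of_real x powr (s - 1) * (of_real x powr \<alpha> * F x) = of_real x powr (s + \<alpha> - 1) * F x"
      by (simp only: mult.assoc[symmetric])
  qed
qed auto

text \<open>Polar form of \<open>1 + \<i> * t\<close>: the \<open>n\<close> powers of the modulus
  split off from the exponent \<open>- (\<zeta> - n)\<close> combine with
  \<open>sgn (Complex 1 t) powi n\<close>, and the remaining modulus power is
  \<open>(1 + t\<^sup>2) powr (- \<zeta> / 2)\<close>.\<close>

lemma I_integrand_eq:
  "sgn (Complex 1 t) powi n * of_real t powr (- \<xi>) * of_real (norm (Complex 1 t)) powr (- (\<zeta> - of_int n)) =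
   I_integrand n \<zeta> \<xi> t"
proof -
  have C: "Complex 1 t = 1 + \<i> * of_real t" by (simp add: Complex_eq)
  define m where "m = norm (Complex 1 t)"
  have nz: "Complex 1 t \<noteq> 0" by (simp add: complex_eq_iff)
  then have "m > 0" by (simp add: m_def)
  have m2: "1 + t\<^sup>2 = m\<^sup>2" by (simp add: m_def cmod_power2)
  have "of_real m powr (- (\<zeta> - of_int n)) = of_real m powr (- \<zeta>) * complex_of_real m powr of_int n"
    by (simp flip: powr_add)
  also have "complex_of_real m powr of_int n = of_real m powi n"
    using \<open>m > 0\<close> by (subst powr_of_int) (auto simp: power_int_def power_inverse)
  also have "of_real m powr (- \<zeta>) = complex_of_real (1 + t\<^sup>2) powr (- \<zeta> / 2)"
    unfolding m2 using \<open>m > 0\<close> by (auto simp: powr_def Ln_of_real ln_realpow simp flip: of_real_power)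
  finally have "of_real m powr (- (\<zeta> - of_int n)) = complex_of_real (1 + t\<^sup>2) powr (- \<zeta> / 2) * of_real m powi n" .
  moreover have "sgn (Complex 1 t) powi n * of_real m powi n = Complex 1 t powi n"
    using nz by (simp add: power_int_mult_distrib[symmetric] sgn_eq m_def)
  ultimately show ?thesis
    unfolding I_integrand_def C[symmetric] m_def[symmetric] by (simp add: mult_ac)
qed

context half_space_function
begin

text \<open>Under \<open>u = l * t\<close> the direction of \<open>Complex l u\<close> depends on
  \<open>t\<close> alone and its norm becomes \<open>l * norm (Complex 1 t)\<close>. The Jacobian
  and \<open>u powr (- \<xi>)\<close> contribute \<open>l powr (1 - \<xi>)\<close>, which explains
  the exponent \<open>\<xi> - n - 1\<close> in \<open>G_star2\<close>: only
  \<open>l powr (- n)\<close> is left.\<close>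

lemma rescale_line_integral:
  assumes "l > 0"
  shows "of_real l powr (\<xi> - of_int n - 1) *
      (LINT u:{0<..}|lborel. sgn (Complex l u) powi n * of_real u powr (- \<xi>) * Fm \<xi> (norm (Complex l u))) =
    of_real l powr (- of_int n) *
      (LINT t:{0<..}|lborel. (sgn (Complex 1 t) powi n * of_real t powr (- \<xi>)) * Fm \<xi> (l * norm (Complex 1 t)))"
proof -
  have Complex_l: "Complex l (l * t) = l *\<^sub>R Complex 1 t" for t
    by (simp add: complex_eq_iff)
  have "(LINT u:{0<..}|lborel. sgn (Complex l u) powi n * of_real u powr (- \<xi>) * Fm \<xi> (norm (Complex l u))) =
    (LINT t|lborel. l *\<^sub>R (indicator {0<..} (l * t) *\<^sub>R
      (sgn (Complex l (l * t)) powi n * of_real (l * t) powr (- \<xi>) * Fm \<xi> (norm (Complex l (l * t))))))"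
    unfolding set_lebesgue_integral_def using assms
    by (subst lborel_integral_real_affine[of l _ 0]) (simp_all only: integral_scaleR_right abs_of_pos add_0)
  also have "\<dots> = (LINT t|lborel. of_real l powr (1 - \<xi>) * (indicator {0<..} t *\<^sub>R
     ((sgn (Complex 1 t) powi n * of_real t powr (- \<xi>)) * Fm \<xi> (l * norm (Complex 1 t)))))"
  proof (intro Bochner_Integration.integral_cong refl)
    fix t :: real
    show "l *\<^sub>R (indicator {0<..} (l * t) *\<^sub>R
      (sgn (Complex l (l * t)) powi n * of_real (l * t) powr (- \<xi>) * Fm \<xi> (norm (Complex l (l * t))))) =
      of_real l powr (1 - \<xi>) * (indicator {0<..} t *\<^sub>R
     ((sgn (Complex 1 t) powi n * of_real t powr (- \<xi>)) * Fm \<xi> (l * norm (Complex 1 t))))"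
    proof (cases "t > 0")
      case True
      have "of_real l * complex_of_real (l * t) powr (- \<xi>) = of_real l powr (1 - \<xi>) * of_real t powr (- \<xi>)"
        using assms True by (simp add: powr_times_real_left powr_diff powr_minus divide_inverse)
      then have "of_real l * complex_of_real (l * t) powr (- \<xi>) * (P * F) = of_real l powr (1 - \<xi>) * of_real t powr (- \<xi>) * (P * F)" for P F
        by (simp only:)
      then have eq: "of_real l * (P * complex_of_real (l * t) powr (- \<xi>) * F) = of_real l powr (1 - \<xi>) * (P * of_real t powr (- \<xi>) * F)" for P F
        by (simp only: mult_ac)
      have ind: "indicator {0<..} (l * t) = (1::real)" "indicator {0<..} t = (1::real)"
        using assms True by auto
      have sgn: "sgn (Complex l (l * t)) = sgn (Complex 1 t)" "norm (Complex l (l * t)) = l * norm (Complex 1 t)"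
        using assms by (auto simp: Complex_l sgn_scaleR)
      show ?thesis
        unfolding ind sgn scaleR_one unfolding scaleR_conv_of_real by (rule eq)
    next
      case False
      then show ?thesis using assms by (simp add: zero_less_mult_iff)
    qed
  qed
  also have "\<dots> = of_real l powr (1 - \<xi>) *
     (LINT t:{0<..}|lborel. (sgn (Complex 1 t) powi n * of_real t powr (- \<xi>)) * Fm \<xi> (l * norm (Complex 1 t)))"
    by (simp only: set_lebesgue_integral_def integral_mult_right_zero)
  finally show ?thesis
    using assms by (simp add: mult.assoc[symmetric] powr_add[symmetric])
qed

text \<open>A superposition with dilation factors \<open>norm (Complex 1 t)\<close> and the same
  function for all \<open>t\<close>, so its Mellin transform comes out of the integral and what
  remains is the kernel. The bound \<open>Re \<zeta> - n > 1\<close> serves twice: for the weight at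
  infinity and for the majorant on \<open>{0..R}\<close> at 0.\<close>

lemma mellin_rescaled_line_integral:
  assumes \<xi>: "0 < Re \<xi>" "Re \<xi> < 1" and \<zeta>: "Re \<zeta> > real_of_int n + 1"
  shows "mellin (\<lambda>l. LINT t:{0<..}|lborel. (sgn (Complex 1 t) powi n * of_real t powr (- \<xi>)) * Fm \<xi> (l * norm (Complex 1 t)))
      (\<zeta> - of_int n) = I_fun n \<zeta> \<xi> * mellin (Fm \<xi>) (\<zeta> - of_int n)"
proof -
  let ?w = "\<lambda>t. sgn (Complex 1 t) powi n * of_real t powr (- \<xi>)"
  let ?c = "\<lambda>t. norm (Complex 1 t)"
  let ?\<sigma> = "Re \<zeta> - real_of_int n"
  have [measurable]: "(\<lambda>t. sgn (Complex 1 t) powi n) \<in> borel_measurable borel"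
    by (rule sgn_Complex_measurable) simp
  have c_m: "?c \<in> borel_measurable borel"
    by (intro borel_measurable_continuous_onI) (auto simp: Complex_eq intro!: continuous_intros)
  have c_powr: "?c t powr (- ?\<sigma>) = (1 + t\<^sup>2) powr (- ?\<sigma> / 2)" for t
  proof -
    have "?c t = (1 + t\<^sup>2) powr (1 / 2)"
      by (simp add: cmod_def powr_half_sqrt add_nonneg_nonneg)
    then show ?thesis by (simp add: powr_powr)
  qed
  obtain B where B: "\<And>r. norm (Fm \<xi> r) \<le> B" using Fm_bounded by blast
  have w_int: "set_integrable lborel {0<..} (\<lambda>t. norm (?w t) * ?c t powr (- ?\<sigma>))"
    unfolding set_integrable_def c_powr
  proof (rule Bochner_Integration.integrable_bound)
    show "integrable lborel (\<lambda>t. indicator {0<..} t *\<^sub>R (t powr (- Re \<xi>) * (1 + t\<^sup>2) powr (- ?\<sigma> / 2)))"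
      using set_integrable_powr_weight[of "Re \<xi>" ?\<sigma>] \<xi> \<zeta> by (simp only: set_integrable_def)
    have "norm (?w t) * (1 + t\<^sup>2) powr (- ?\<sigma> / 2) \<le> t powr (- Re \<xi>) * (1 + t\<^sup>2) powr (- ?\<sigma> / 2)" if "t > 0" for t
    proof (rule mult_right_mono)
      have "norm (?w t) \<le> 1 * norm (complex_of_real t powr (- \<xi>))"
        unfolding norm_mult by (intro mult_right_mono norm_sgn_powi) auto
      then show "norm (?w t) \<le> t powr (- Re \<xi>)"
        using that by (simp add: norm_powr_real_powr)
    qed simp
    then show "AE t in lborel. norm (indicator {0<..} t *\<^sub>R (norm (?w t) * (1 + t\<^sup>2) powr (- ?\<sigma> / 2)))
        \<le> norm (indicator {0<..} t *\<^sub>R (t powr (- Re \<xi>) * (1 + t\<^sup>2) powr (- ?\<sigma> / 2)))"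
      by (intro AE_I2) (auto simp: indicator_def)
  qed measurable
  have "set_integrable lborel {0..max 0 R} (\<lambda>x. x powr (?\<sigma> - 1))"
    using \<zeta> by (intro set_integrable_lborel_nonneg integrable_on_powr_from_0) auto
  then have "integrable lborel (\<lambda>x. (indicator {0..max 0 R} x *\<^sub>R x powr (?\<sigma> - 1)) * B)"
    unfolding set_integrable_def by (rule integrable_mult_left)
  then have M_int: "set_integrable lborel {0<..} (\<lambda>x. x powr (?\<sigma> - 1) * (indicator {0..R} x * B))"
    unfolding set_integrable_def
    by (rule Bochner_Integration.integrable_bound) (auto simp: indicator_def)
  have "B \<ge> 0" using B[of 0] norm_ge_zero order_trans by blast
  then have dom: "norm (Fm \<xi> x) \<le> indicator {0..R} x * B" if "x > 0" for x
    using Fm_supp[of \<xi> x] B[of x] that by (cases "Fm \<xi> x = 0") (simp_all add: indicator_def)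
  have c_pos: "?c t > 0" for t
    by (simp add: complex_eq_iff)
  have "mellin (\<lambda>l. LINT t:{0<..}|lborel. ?w t * Fm \<xi> (l * ?c t)) (\<zeta> - of_int n) =
    (LINT t:{0<..}|lborel. ?w t * of_real (?c t) powr (- (\<zeta> - of_int n)) * mellin (Fm \<xi>) (\<zeta> - of_int n))"
    by (rule mellin_superposition[where M = "\<lambda>x. indicator {0..R} x * B" and F = "\<lambda>t. Fm \<xi>"])
       (use c_m c_pos w_int M_int dom in auto)
  also have "\<dots> = I_fun n \<zeta> \<xi> * mellin (Fm \<xi>) (\<zeta> - of_int n)"
    unfolding I_integrand_eq I_fun_eq by (rule set_integral_mult_left)
  finally show ?thesis .
qed

end

section \<open>Transfer to the line integrals of \<open>f\<close>\<close>

locale line_transform =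
  fixes f :: "real^3 \<Rightarrow> complex" and R a b C :: real and n :: int
  assumes half_space: "half_space_function (\<lambda>z \<tau>. f (vector [Re z, Im z, \<tau>])) R a b C"

sublocale line_transform \<subseteq> half_space_function "\<lambda>z \<tau>. f (vector [Re z, Im z, \<tau>])" R a b C n
  by (rule half_space)

context line_transform
begin

lemma f_coeff_eq: "f_coeff f n r \<tau> = fc r \<tau>"
  by (simp add: f_coeff_def fc_def)

text \<open>The direction vector has norm 1, so the length element is \<open>dt\<close>; the first
  two coordinates are those of \<open>cis \<phi> * Complex l (t * cos \<theta>)\<close>.\<close>

lemma line_int_eq:
  "line_int f l \<theta> \<phi> = (LINT t|lborel. f (vector
     [Re (cis \<phi> * Complex l (t * cos \<theta>)), Im (cis \<phi> * Complex l (t * cos \<theta>)), t * sin \<theta>]))"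
proof -
  have deriv: "(line_pt l \<theta> \<phi> has_vector_derivative
      vector [- cos \<theta> * sin \<phi>, cos \<theta> * cos \<phi>, sin \<theta>]) (at t)" for t
  proof -
    have "line_pt l \<theta> \<phi> = (\<lambda>t. vector [l * cos \<phi>, l * sin \<phi>, 0] +
        t *\<^sub>R vector [- cos \<theta> * sin \<phi>, cos \<theta> * cos \<phi>, sin \<theta>])"
      by (simp add: fun_eq_iff line_pt_def vec_eq_iff forall_3 vector_3 algebra_simps)
    then show ?thesis
      by (auto intro!: derivative_eq_intros)
  qed
  have "norm (vector [- cos \<theta> * sin \<phi>, cos \<theta> * cos \<phi>, sin \<theta>] :: real^3) = 1"
  proof -
    have "(cos \<theta> * sin \<phi>)\<^sup>2 + (cos \<theta> * cos \<phi>)\<^sup>2 + (sin \<theta>)\<^sup>2 = (cos \<theta>)\<^sup>2 * ((sin \<phi>)\<^sup>2 + (cos \<phi>)\<^sup>2) + (sin \<theta>)\<^sup>2"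
      by algebra
    also have "\<dots> = 1" by (simp only: sin_cos_squared_add sin_cos_squared_add2 mult_1_right)
    finally have sq: "(cos \<theta> * sin \<phi>)\<^sup>2 + (cos \<theta> * cos \<phi>)\<^sup>2 + (sin \<theta>)\<^sup>2 = 1" .
    have "norm (vector [- cos \<theta> * sin \<phi>, cos \<theta> * cos \<phi>, sin \<theta>] :: real^3) =
        sqrt ((cos \<theta> * sin \<phi>)\<^sup>2 + (cos \<theta> * cos \<phi>)\<^sup>2 + (sin \<theta>)\<^sup>2)"
      by (simp add: norm_vec_def L2_set_def sum_3 vector_3)
    then show ?thesis by (simp only: sq real_sqrt_one)
  qed
  then have "norm (vector_derivative (line_pt l \<theta> \<phi>) (at t)) = 1" for t
    using vector_derivative_at[OF deriv] by simp
  then show ?thesis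
    by (simp add: line_int_def line_pt_def algebra_simps)
qed

text \<open>The scaling factor \<open>k = sqrt (1 + s\<^sup>2)\<close> is
  \<open>1 / cos (arctan s)\<close>; as a Jacobian it cancels the denominator in
  \<open>G_star\<close>.\<close>

lemma G_star_eq:
  assumes "l > 0" "s > 0"
  shows "G_star f n l s = (LINT u:{0<..}|lborel. (indicator {..R} u * sgn (Complex l u) powi n) * fc (norm (Complex l u)) (s * u))"
proof -
  let ?p = "\<lambda>z \<tau>. f (vector [Re z, Im z, \<tau>])"
  define k where "k = sqrt (1 + s\<^sup>2)"
  have "k > 0" by (simp add: k_def add_pos_nonneg)
  have scale: "(0 + k * u) * cos (arctan s) = u" "(0 + k * u) * sin (arctan s) = s * u" for u
    using \<open>k > 0\<close> by (simp_all add: cos_arctan sin_arctan flip: k_def)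
  have "line_int f l (arctan s) \<phi> = of_real k * (LINT u|lborel. ?p (cis \<phi> * Complex l u) (s * u))" for \<phi>
  proof -
    have "line_int f l (arctan s) \<phi> = \<bar>k\<bar> *\<^sub>R (LINT u|lborel. ?p (cis \<phi> * Complex l ((0 + k * u) * cos (arctan s))) ((0 + k * u) * sin (arctan s)))"
      unfolding line_int_eq using \<open>k > 0\<close> by (intro lborel_integral_real_affine) simp
    then show ?thesis
      unfolding scale using \<open>k > 0\<close> by (simp only: scaleR_conv_of_real abs_of_pos)
  qed
  then have G: "G_coeff f n l (arctan s) = of_real k * fourier_coeff n (\<lambda>\<phi>. LINT u|lborel. ?p (cis \<phi> * Complex l u) (s * u))"
    by (simp add: G_coeff_def fourier_coeff_def mult.assoc)
  have "complex_of_real k \<noteq> 0" using \<open>k > 0\<close> by simp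
  then show ?thesis
    unfolding G_star_def k_def[symmetric] G fourier_coeff_line_pos[OF assms]
    by (rule nonzero_mult_div_cancel_left)
qed

lemma mellin_G_star2:
  assumes \<xi>: "0 < Re \<xi>" "Re \<xi> < 1" and \<zeta>: "Re \<zeta> > real_of_int n + 1"
  shows "mellin (\<lambda>l. G_star2 f n l \<xi>) \<zeta> = I_fun n \<zeta> \<xi> * mellin (Fm \<xi>) (\<zeta> - of_int n)"
proof -
  have "mellin (\<lambda>l. G_star2 f n l \<xi>) \<zeta> = mellin (\<lambda>l. of_real l powr (- of_int n) *
      (LINT t:{0<..}|lborel. (sgn (Complex 1 t) powi n * of_real t powr (- \<xi>)) * Fm \<xi> (l * norm (Complex 1 t)))) \<zeta>"
  proof (rule mellin_cong)
    fix l :: real assume l: "l > 0"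
    have "mellin (G_star f n l) \<xi> =
       (LINT u:{0<..}|lborel. sgn (Complex l u) powi n * of_real u powr (- \<xi>) * Fm \<xi> (norm (Complex l u)))"
      using mellin_cong[OF G_star_eq[OF l], where s = \<xi>] mellin_line[OF l \<xi>(2)] by simp
    then show "G_star2 f n l \<xi> = of_real l powr (- of_int n) *
      (LINT t:{0<..}|lborel. (sgn (Complex 1 t) powi n * of_real t powr (- \<xi>)) * Fm \<xi> (l * norm (Complex 1 t)))"
      unfolding G_star2_def using rescale_line_integral[OF l, where \<xi> = \<xi>] by simp
  qed
  also have "\<dots> = I_fun n \<zeta> \<xi> * mellin (Fm \<xi>) (\<zeta> - of_int n)"
    unfolding mellin_powr_shift using mellin_rescaled_line_integral[OF assms] by simp
  finally show ?thesis .
qed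

end

section \<open>The inversion formula\<close>

lemma continuous_on_vector3 [continuous_intros]:
  fixes u v w :: "'a::topological_space \<Rightarrow> real"
  assumes "continuous_on A u" "continuous_on A v" "continuous_on A w"
  shows "continuous_on A (\<lambda>x. vector [u x, v x, w x] :: real^3)"
proof -
  have "(vector [u x, v x, w x] :: real^3) =
      u x *\<^sub>R vector [1, 0, 0] + v x *\<^sub>R vector [0, 1, 0] + w x *\<^sub>R vector [0, 0, 1]" for x
    by (simp add: vec_eq_iff forall_3 vector_3)
  then show ?thesis
    using assms by (simp add: continuous_intros)
qed

text \<open>The minimum of the third coordinate over the compact support is attained, hence
  positive, and provides \<open>a\<close>. The radius \<open>R\<close> of a ball containing the
  support bounds both the horizontal distance and the height.\<close>

lemma ex_half_space_function:
  fixes f :: "real^3 \<Rightarrow> complex"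
  assumes f_cont: "continuous_on UNIV f"
    and f_supp: "compact (closure {x. f x \<noteq> 0})"
    and f_half: "closure {x. f x \<noteq> 0} \<subseteq> {x. x $ 3 > 0}"
  shows "\<exists>R a b C. half_space_function (\<lambda>z \<tau>. f (vector [Re z, Im z, \<tau>])) R a b C"
proof -
  let ?K = "closure {x. f x \<noteq> 0}"
  have K: "x \<in> ?K" if "f x \<noteq> 0" for x
    by (rule subsetD[OF closure_subset]) (simp add: that)
  obtain R where R: "\<And>x. x \<in> ?K \<Longrightarrow> norm x \<le> R"
    using compact_imp_bounded[OF f_supp] unfolding bounded_iff by blast
  obtain a where a: "a > 0" "\<And>x. x \<in> ?K \<Longrightarrow> a \<le> x $ 3"
  proof (cases "?K = {}")
    case True
    \<comment> \<open>For empty support every positive number is a lower bound.\<close>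
    then show ?thesis using that[of 1] by auto
  next
    case False
    have "continuous_on ?K (\<lambda>x. x $ 3)" by (intro continuous_intros)
    from continuous_attains_inf[OF f_supp False this] obtain y :: "real^3" where "y \<in> ?K" "\<And>x :: real^3. x \<in> ?K \<Longrightarrow> y $ 3 \<le> x $ 3"
      by blast
    then show ?thesis using that[of "y $ 3"] f_half by auto
  qed
  have "compact (f ` ?K)"
    using f_cont f_supp by (intro compact_continuous_image) (auto intro: continuous_on_subset)
  then obtain C where C: "C > 0" "\<And>x. x \<in> ?K \<Longrightarrow> norm (f x) \<le> C"
    using compact_imp_bounded bounded_pos by (metis image_eqI)
  have "half_space_function (\<lambda>z \<tau>. f (vector [Re z, Im z, \<tau>])) R a R C"
  proof
    show "continuous_on UNIV (\<lambda>(z, \<tau>). f (vector [Re z, Im z, \<tau>]))"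
      unfolding case_prod_beta
      by (rule continuous_on_compose2[OF f_cont]) (auto intro!: continuous_intros)
    show "norm z \<le> R \<and> a \<le> \<tau> \<and> \<tau> \<le> R" if "f (vector [Re z, Im z, \<tau>]) \<noteq> 0" for z \<tau>
    proof -
      let ?x = "vector [Re z, Im z, \<tau>] :: real^3"
      have x: "?x \<in> ?K" using K that by blast
      have norm_x: "norm ?x = sqrt ((Re z)\<^sup>2 + (Im z)\<^sup>2 + \<tau>\<^sup>2)"
        by (simp add: norm_vec_def L2_set_def sum_3 vector_3)
      have "norm z \<le> norm ?x"
        unfolding norm_x cmod_def by (intro real_sqrt_le_mono) simp
      moreover have "\<tau> \<le> norm ?x"
        using component_le_norm_cart[of ?x 3] by (simp add: vector_3)
      ultimately show ?thesis
        using R[OF x] a(2)[OF x] by (simp add: vector_3)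
    qed
    show "norm (f (vector [Re z, Im z, \<tau>])) \<le> C" for z \<tau>
      using C(1) C(2)[OF K] by (cases "f (vector [Re z, Im z, \<tau>]) = 0") auto
  qed (use a in auto)
  then show ?thesis by blast
qed

lemma powi_measurable [measurable]:
  "(\<lambda>x::real. complex_of_real x powi k) \<in> borel_measurable borel"
  unfolding power_int_def by (cases "k \<ge> 0") simp_all

lemma of_real_powi_eq_powr:
  assumes "x > 0"
  shows "complex_of_real x powi k = of_real x powr of_int k"
  using assms by (subst powr_of_int) (auto simp: power_int_def power_inverse)

lemma norm_of_real_powi:
  assumes "x > 0"
  shows "norm (complex_of_real x powi k) = x powr of_int k"
  using assms by (simp add: of_real_powi_eq_powr norm_powr_real_powr)

context line_transform
begin

text \<open>The limit of the inner inversion: the power of \<open>r\<close> turns the Mellin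
  transform of \<open>Fm \<xi>\<close> at \<open>\<zeta> - n\<close> into one at
  \<open>\<zeta>\<close>. As it does not involve \<open>\<tau>\<close>, \<open>W r\<close> is also
  the Mellin transform of \<open>V r\<close>, so the two inversions chain.\<close>

definition W :: "real \<Rightarrow> complex \<Rightarrow> complex" where
  "W r \<xi> = of_real r powi (- n) * Fm \<xi> r"

definition V :: "real \<Rightarrow> real \<Rightarrow> complex" where
  "V r \<tau> = of_real r powi (- n) * fc r \<tau>"

text \<open>\<open>Fm \<xi>\<close> is bounded with bounded support but may be nonzero at 0, so
  \<open>x powr (\<rho> - n - 1)\<close> has to be integrable there; this is the condition
  \<open>\<rho> > n\<close>.\<close>

lemma inversion_r:
  assumes \<rho>: "\<rho> > real_of_int n" and "r > 0"
  shows "mellin_inversion (\<lambda>r. W r \<xi>) \<rho> r"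
proof
  show "(\<lambda>r. W r \<xi>) \<in> borel_measurable borel"
    unfolding W_def by measurable
  obtain B where B: "\<And>r. norm (Fm \<xi> r) \<le> B" using Fm_bounded by blast
  then have "B \<ge> 0" using B[of 0] norm_ge_zero order_trans by blast
  have norm_W: "x powr \<alpha> * norm (W x \<xi>) = x powr (\<alpha> - n) * norm (Fm \<xi> x)" if "x > 0" for x \<alpha>
    using that by (simp add: W_def norm_mult norm_of_real_powi powr_diff powr_minus divide_inverse)
  have "set_integrable lborel {0..max 0 R} (\<lambda>x. x powr (\<rho> - n - 1))"
    using \<rho> by (intro set_integrable_lborel_nonneg integrable_on_powr_from_0) auto
  then have "integrable lborel (\<lambda>x. (indicator {0..max 0 R} x *\<^sub>R x powr (\<rho> - n - 1)) * B)"
    unfolding set_integrable_def by (rule integrable_mult_left)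
  then show "set_integrable lborel {0<..} (\<lambda>x. of_real (x powr (\<rho> - 1)) * W x \<xi>)"
    unfolding set_integrable_def
  proof (rule Bochner_Integration.integrable_bound)
    show "AE x in lborel. norm (indicator {0<..} x *\<^sub>R (of_real (x powr (\<rho> - 1)) * W x \<xi>))
        \<le> norm ((indicator {0..max 0 R} x *\<^sub>R x powr (\<rho> - n - 1)) * B)"
    proof (intro AE_I2)
      fix x :: real
      show "norm (indicator {0<..} x *\<^sub>R (of_real (x powr (\<rho> - 1)) * W x \<xi>))
        \<le> norm ((indicator {0..max 0 R} x *\<^sub>R x powr (\<rho> - n - 1)) * B)"
      proof (cases "x > 0 \<and> Fm \<xi> x \<noteq> 0")
        case True
        then have "x \<le> R" using Fm_supp[of \<xi> x] by simp
        have "x powr (\<rho> - 1) * norm (W x \<xi>) = x powr (\<rho> - n - 1) * norm (Fm \<xi> x)"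
          using norm_W[of x "\<rho> - 1"] True by (simp add: algebra_simps)
        also have "\<dots> \<le> x powr (\<rho> - n - 1) * B"
          by (intro mult_left_mono B) auto
        finally show ?thesis
          using True \<open>x \<le> R\<close> \<open>B \<ge> 0\<close> by (simp add: norm_mult)
      qed (auto simp: W_def)
    qed
  qed (simp add: W_def)
  show "\<exists>B. \<forall>x>0. x powr \<rho> * norm (W x \<xi>) \<le> B"
  proof (intro exI allI impI)
    fix x :: real assume "x > 0"
    show "x powr \<rho> * norm (W x \<xi>) \<le> max 0 R powr (\<rho> - n) * B"
    proof (cases "Fm \<xi> x = 0")
      case False
      then have "x \<le> max 0 R" using Fm_supp[of \<xi> x] by simp
      then show ?thesis
        unfolding norm_W[OF \<open>x > 0\<close>] using \<open>x > 0\<close> \<rho> by (intro mult_mono B powr_mono2) auto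
    qed (use \<open>B \<ge> 0\<close> in \<open>simp add: W_def\<close>)
  qed
  have "isCont (Fm \<xi>) r"
    using Fm_cont by (simp add: continuous_on_eq_continuous_at)
  then show "isCont (\<lambda>r. W r \<xi>) r"
    unfolding W_def using \<open>r > 0\<close> by (intro continuous_intros) auto
qed fact

lemma inversion_\<tau>:
  assumes "\<rho> > 0" and "\<tau> > 0"
  shows "mellin_inversion (V r) \<rho> \<tau>"
proof
  have cont: "continuous_on A (V r)" for A
    unfolding V_def by (intro continuous_intros)
  then show "V r \<in> borel_measurable borel"
    by (rule borel_measurable_continuous_onI)
  have supp: "V r x \<noteq> 0 \<Longrightarrow> x \<in> {a..b}" for x
    using fc_supp[of r x] by (auto simp: V_def)
  have "set_integrable lborel {a..b} (\<lambda>x. of_real (x powr (\<rho> - 1)) * V r x)"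
    using a_pos by (intro borel_integrable_atLeastAtMost' continuous_intros cont) auto
  moreover have "indicator {a..b} x *\<^sub>R (of_real (x powr (\<rho> - 1)) * V r x) =
      indicator {0<..} x *\<^sub>R (of_real (x powr (\<rho> - 1)) * V r x)" for x
    using supp[of x] a_pos by (cases "V r x = 0") (auto simp: indicator_def)
  ultimately show "set_integrable lborel {0<..} (\<lambda>x. of_real (x powr (\<rho> - 1)) * V r x)"
    by (simp only: set_integrable_def)
  let ?c = "norm (complex_of_real r powi (- n))"
  have "C \<ge> 0" using fc_bound[of 0 0] norm_ge_zero order_trans by blast
  show "\<exists>B. \<forall>x>0. x powr \<rho> * norm (V r x) \<le> B"
  proof (intro exI allI impI)
    fix x :: real assume "x > 0"
    show "x powr \<rho> * norm (V r x) \<le> b powr \<rho> * (?c * C)"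
    proof (cases "V r x = 0")
      case False
      then show ?thesis
        using supp[of x] \<open>x > 0\<close> \<open>\<rho> > 0\<close>
        by (intro mult_mono powr_mono2) (auto simp: V_def norm_mult intro!: mult_left_mono fc_bound)
    qed (use \<open>C \<ge> 0\<close> in simp)
  qed
  show "isCont (V r) \<tau>"
    using cont[of UNIV] by (simp add: continuous_on_eq_continuous_at)
qed fact

lemma mellin_V: "mellin (V r) \<xi> = W r \<xi>"
proof -
  have "of_real y powr (\<xi> - 1) * V r y = of_real r powi (- n) * (of_real y powr (\<xi> - 1) * fc r y)" for y
    by (simp only: V_def mult.left_commute)
  then show ?thesis
    by (simp only: mellin_def W_def Fm_def set_integral_mult_right)
qed

lemma U_fun_eq:
  assumes "0 < Re \<xi>" "Re \<xi> < 1" "Re \<zeta> > real_of_int n + 1" "I_fun n \<zeta> \<xi> \<noteq> 0"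
  shows "U_fun f n \<zeta> \<xi> = mellin (\<lambda>r. W r \<xi>) \<zeta>"
proof -
  have "mellin (\<lambda>r. W r \<xi>) \<zeta> = mellin (\<lambda>r. of_real r powr (- of_int n) * Fm \<xi> r) \<zeta>"
    by (rule mellin_cong) (simp add: W_def of_real_powi_eq_powr)
  then show ?thesis
    using assms by (simp add: mellin_powr_shift U_fun_def mellin_G_star2)
qed

lemma countable_exceptional:
  assumes "0 < Re \<xi>" "Re \<xi> < 1" "\<rho> > real_of_int n + 1"
  shows "countable {y. I_fun n (Complex \<rho> y) \<xi> = 0}"
proof (rule countable_image_inj_on[of "Complex \<rho>"])
  show "countable (Complex \<rho> ` {y. I_fun n (Complex \<rho> y) \<xi> = 0})"
    by (rule countable_subset[OF _ countable_I_fun_zeros[OF assms(1,2), of n]]) (use assms(3) in auto)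
qed (auto simp: inj_on_def)

end

text \<open>The Cesaro part supplies existence at every interior point, and the last part shows that
  convergent ordinary line integrals can give no other value. At \<open>r = 0\<close> or
  \<open>\<tau> = 0\<close> the powers in the inversion integrals degenerate, so boundary values are
  reached as limits through the continuity of the coefficient.\<close>

theorem theorem2p5:
  fixes f :: "real^3 \<Rightarrow> complex" and n :: int and \<rho>1 \<rho>2 :: real
  assumes f_cont: "continuous_on UNIV f"
    and f_supp: "compact (closure {x. f x \<noteq> 0})"
    and f_half: "closure {x. f x \<noteq> 0} \<subseteq> {x. x $ 3 > 0}"
    and \<rho>1: "\<rho>1 > real_of_int (max 0 (n + 1))"
    and \<rho>2: "0 < \<rho>2" "\<rho>2 < 1"
  shows "(\<exists>W V.
           (\<forall>r>0. \<forall>\<xi>. Re \<xi> = \<rho>2 \<longrightarrow> has_inv_mellin_C1 \<rho>1 (\<lambda>\<zeta>. U_fun f n \<zeta> \<xi>) r (W r \<xi>)) \<and>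
           (\<forall>r>0. \<forall>\<tau>>0. has_inv_mellin_C1 \<rho>2 (W r) \<tau> (V r \<tau>)) \<and>
           (\<forall>r>0. \<forall>\<tau>>0. f_coeff f n r \<tau> = of_real r powi n * V r \<tau>) \<and>
           (\<forall>r\<ge>0. \<forall>\<tau>\<ge>0.
              ((\<lambda>(r', \<tau>'). of_real r' powi n * V r' \<tau>') \<longlongrightarrow> f_coeff f n r \<tau>)
                (at (r, \<tau>) within {0<..} \<times> {0<..})))
       \<and> (\<forall>r>0. \<forall>\<tau>>0. \<forall>W v.
           (\<forall>\<xi>. Re \<xi> = \<rho>2 \<longrightarrow> has_inv_mellin \<rho>1 (\<lambda>\<zeta>. U_fun f n \<zeta> \<xi>) r (W \<xi>)) \<longrightarrow>
           has_inv_mellin \<rho>2 W \<tau> v \<longrightarrow>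
           f_coeff f n r \<tau> = of_real r powi n * v)"
proof -
  obtain R a b C where half_space: "half_space_function (\<lambda>z \<tau>. f (vector [Re z, Im z, \<tau>])) R a b C"
    using ex_half_space_function[OF f_cont f_supp f_half] by blast
  interpret line_transform f R a b C n
    by (rule line_transform.intro[OF half_space])
  have \<rho>1': "\<rho>1 > real_of_int n + 1" "\<rho>1 > real_of_int n"
    using \<rho>1 by auto
  have U: "U_fun f n (Complex \<rho>1 y) \<xi> = mellin (\<lambda>r. W r \<xi>) (Complex \<rho>1 y)"
    if "Re \<xi> = \<rho>2" "y \<notin> {y. I_fun n (Complex \<rho>1 y) \<xi> = 0}" for y \<xi>
    using that \<rho>1' \<rho>2 by (intro U_fun_eq) auto
  have Z: "countable {y. I_fun n (Complex \<rho>1 y) \<xi> = 0}" if "Re \<xi> = \<rho>2" for \<xi>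
    using that \<rho>1' \<rho>2 by (intro countable_exceptional) auto
  have V: "f_coeff f n r \<tau> = of_real r powi n * V r \<tau>" if "r > 0" for r \<tau>
    using that by (simp add: f_coeff_eq V_def power_int_minus)
  show ?thesis
  proof (intro conjI exI[of _ W] exI[of _ V] allI impI)
    fix r :: real and \<xi> :: complex assume "r > 0" and \<xi>: "Re \<xi> = \<rho>2"
    then show "has_inv_mellin_C1 \<rho>1 (\<lambda>\<zeta>. U_fun f n \<zeta> \<xi>) r (W r \<xi>)"
      using U[OF \<xi>] Z[OF \<xi>]
      by (intro mellin_inversion.has_inv_mellin_C1[OF inversion_r[OF \<rho>1'(2)]])
  next
    fix r \<tau> :: real assume "r > 0" "\<tau> > 0"
    then show "has_inv_mellin_C1 \<rho>2 (W r) \<tau> (V r \<tau>)"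
      by (intro mellin_inversion.has_inv_mellin_C1[OF inversion_\<tau>[OF \<rho>2(1)], where Z = "{}"])
         (simp_all add: mellin_V)
  next
    fix r \<tau> :: real assume "r > 0" "\<tau> > 0"
    then show "f_coeff f n r \<tau> = of_real r powi n * V r \<tau>" by (intro V)
  next
    fix r \<tau> :: real
    let ?S = "{0<..} \<times> {0<..} :: (real \<times> real) set"
    have "((\<lambda>(r', \<tau>'). fc r' \<tau>') \<longlongrightarrow> fc r \<tau>) (at (r, \<tau>))"
      using fc_cont by (auto simp: continuous_on_def)
    then have "((\<lambda>(r', \<tau>'). fc r' \<tau>') \<longlongrightarrow> fc r \<tau>) (at (r, \<tau>) within ?S)"
      by (rule tendsto_within_subset) simp
    moreover have "\<forall>\<^sub>F z in at (r, \<tau>) within ?S.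
        (case z of (r', \<tau>') \<Rightarrow> fc r' \<tau>') = (case z of (r', \<tau>') \<Rightarrow> of_real r' powi n * V r' \<tau>')"
      using V unfolding eventually_at_filter by (intro always_eventually) (auto simp: f_coeff_eq)
    ultimately show "((\<lambda>(r', \<tau>'). of_real r' powi n * V r' \<tau>') \<longlongrightarrow> f_coeff f n r \<tau>)
        (at (r, \<tau>) within ?S)"
      unfolding f_coeff_eq by (rule Lim_transform_eventually)
  next
    fix r \<tau> :: real and W' :: "complex \<Rightarrow> complex" and v :: complex
    assume r: "r > 0" and \<tau>: "\<tau> > 0"
      and W': "\<forall>\<xi>. Re \<xi> = \<rho>2 \<longrightarrow> has_inv_mellin \<rho>1 (\<lambda>\<zeta>. U_fun f n \<zeta> \<xi>) r (W' \<xi>)"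
      and v: "has_inv_mellin \<rho>2 W' \<tau> v"
    have "W' \<xi> = W r \<xi>" if "Re \<xi> = \<rho>2" for \<xi>
      using mellin_inversion.has_inv_mellin_unique[OF inversion_r[OF \<rho>1'(2) r] U[OF that] Z[OF that]] W' that
      by blast
    \<comment> \<open>The zeros of the kernel affect only the inner integral. Its limit is the exact
      Mellin transform of \<open>V r\<close> on the whole line \<open>Re \<xi> = \<rho>2\<close>, so
      the outer exceptional set is empty.\<close>
    then have "W' (Complex \<rho>2 y) = mellin (V r) (Complex \<rho>2 y)" for y
      by (simp add: mellin_V)
    then have "v = V r \<tau>"
      by (intro mellin_inversion.has_inv_mellin_unique[OF inversion_\<tau>[OF \<rho>2(1) \<tau>], where Z = "{}" and H = W'])
         (simp_all add: v)
    then show "f_coeff f n r \<tau> = of_real r powi n * v"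
      using V[OF r] by simp
  qed
qed

end
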